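(* Let $n\ge 1$ and let $K$ be a closed curve in $\mathbb{R}^3$ whose $n$th hull $h_n(K)$ is nonempty. Then the total curvature of $K$ is at least $2\pi n$.
   Context: A closed curve $K$ in $\mathbb{R}^d$ is a continuous map from the circle to $\mathbb{R}^d$, modulo reparametrization. Total curvature is in the sense of Milnor: the total curvature of a closed polygon is the sum of its exterior (turning) angles, and the total curvature of an arbitrary closed curve is the supremum (possibly $+\infty$) of the total curvatures of its inscribed polygons (polygons with vertices on $K$ in cyclic order along $K$). The $n$th hull $h_n(K)$ of a closed curve $K$ in $\mathbb{R}^d$ is the set of points $p\in\mathbb{R}^d$ such that $K$ cuts every hyperplane through $p$ at least $2n$ times, with the following counting conventions. Orient $K$ and, given a hyperplane $P$, call its two sides "above" and "below". Consider the connected components of the pullback of $K\cap P$ to the domain circle. If $K\subset P$, then $K$ cuts $P$ twice (once in either direction). If there are infinitely many components, $K$ cuts $P$ infinitely often. Otherwise each component is preceded and followed by open arcs of $K$, each lying to one side of $P$; a component preceded and followed by arcs on the same side of $P$ counts twice, and one preceded and followed by arcs on opposite sides counts once.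
   Formalization: The closed curve is assumed non-constant: for a constant curve the first hull is a single point, hence nonempty, while no inscribed polygon has exterior angles, so its total curvature is undefined (or 0) and the bound 2π fails. *)

theory Defs
  imports "HOL-Analysis.Analysis"
begin

text \<open>
  A closed curve is represented by a parametrization \<open>K :: complex \<Rightarrow> 'a\<close> that is continuous
  on the unit circle \<open>sphere 0 1\<close>; its values elsewhere are irrelevant. All notions below are
  invariant under reparametrization of the circle.
\<close>

definition closed_curve :: "(complex \<Rightarrow> 'a::euclidean_space) \<Rightarrow> bool" where
  "closed_curve K \<longleftrightarrow> continuous_on (sphere 0 1) K"


subsection \<open>Total curvature\<close>

definition exterior_angle :: "'a::euclidean_space \<Rightarrow> 'a \<Rightarrow> real" where
  "exterior_angle v w = arccos (v \<bullet> w / (norm v * norm w))"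

text \<open>
  The list \<open>vs\<close> gives the vertices in cyclic order, with an edge from the last vertex back to
  the first. As in Milnor's definition, cyclically consecutive vertices are distinct, so that
  all exterior angles are defined. A list of length 2 is a doubly covered segment.
\<close>

definition closed_polygon :: "'a::euclidean_space list \<Rightarrow> bool" where
  "closed_polygon vs \<longleftrightarrow>
     vs \<noteq> [] \<and> (\<forall>i<length vs. vs ! i \<noteq> vs ! (Suc i mod length vs))"

definition polygon_total_curvature :: "'a::euclidean_space list \<Rightarrow> real" where
  "polygon_total_curvature vs =
     (\<Sum>i<length vs. exterior_angle
        (vs ! i - vs ! ((i + length vs - 1) mod length vs))
        (vs ! (Suc i mod length vs) - vs ! i))"

definition inscribed_polygon :: "(complex \<Rightarrow> 'a::euclidean_space) \<Rightarrow> 'a list \<Rightarrow> bool" where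
  "inscribed_polygon K vs \<longleftrightarrow> closed_polygon vs \<and>
     (\<exists>ts :: real list. sorted_wrt (<) ts \<and> last ts < hd ts + 2 * pi \<and>
        vs = map (\<lambda>t. K (cis t)) ts)"

definition total_curvature :: "(complex \<Rightarrow> 'a::euclidean_space) \<Rightarrow> ennreal" where
  "total_curvature K =
     (SUP vs \<in> {vs. inscribed_polygon K vs}. ennreal (polygon_total_curvature vs))"


subsection \<open>Cutting hyperplanes and the hulls of a curve\<close>

text \<open>For \<open>u \<noteq> 0\<close>, the pair \<open>(u, c)\<close> represents the hyperplane of all \<open>x\<close> with \<open>u \<bullet> x = c\<close>.\<close>

definition hyperplane :: "'a::euclidean_space \<Rightarrow> real \<Rightarrow> 'a set" where
  "hyperplane u c = {x. u \<bullet> x = c}"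

definition above :: "'a::euclidean_space \<Rightarrow> real \<Rightarrow> 'a set" where
  "above u c = {x. u \<bullet> x > c}"

definition below :: "'a::euclidean_space \<Rightarrow> real \<Rightarrow> 'a set" where
  "below u c = {x. u \<bullet> x < c}"

definition pullback_components ::
    "(complex \<Rightarrow> 'a::euclidean_space) \<Rightarrow> 'a \<Rightarrow> real \<Rightarrow> complex set set" where
  "pullback_components K u c = components {z \<in> sphere 0 1. K z \<in> hyperplane u c}"

text \<open>
  If the pullback has finitely many components and is not the whole circle, then every component
  has the form \<open>cis ` {a..b}\<close> with \<open>a \<le> b < a + 2\<pi>\<close> and, for small \<open>e > 0\<close>, the curve lies strictly
  on one side of the hyperplane on each of \<open>cis ` {a-e<..<a}\<close> and \<open>cis ` {b<..<b+e}\<close>.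
\<close>

definition same_side_component ::
    "(complex \<Rightarrow> 'a::euclidean_space) \<Rightarrow> 'a \<Rightarrow> real \<Rightarrow> complex set \<Rightarrow> bool" where
  "same_side_component K u c C \<longleftrightarrow>
     (\<exists>a b e. a \<le> b \<and> b < a + 2 * pi \<and> C = cis ` {a..b} \<and> e > 0 \<and>
        ((\<forall>t \<in> {a-e<..<a} \<union> {b<..<b+e}. K (cis t) \<in> above u c) \<or>
         (\<forall>t \<in> {a-e<..<a} \<union> {b<..<b+e}. K (cis t) \<in> below u c)))"

definition cuts :: "(complex \<Rightarrow> 'a::euclidean_space) \<Rightarrow> 'a \<Rightarrow> real \<Rightarrow> enat" where
  "cuts K u c =
     (if K ` sphere 0 1 \<subseteq> hyperplane u c then 2
      else if infinite (pullback_components K u c) then \<infinity>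
      else (\<Sum>C \<in> pullback_components K u c. if same_side_component K u c C then 2 else 1))"

definition nth_hull :: "nat \<Rightarrow> (complex \<Rightarrow> 'a::euclidean_space) \<Rightarrow> 'a set" where
  "nth_hull n K = {p. \<forall>u. u \<noteq> 0 \<longrightarrow> enat (2 * n) \<le> cuts K u (u \<bullet> p)}"

end

theory Submission
  imports Defs "HOL-Complex_Analysis.Great_Picard"
begin

text \<open>
  Milnor's averaging argument. For a polygon with edges \<open>a\<^sub>i\<close>, the linear functional \<open>u\<close> has a
  local extremum at a vertex iff \<open>u\<close> takes opposite signs on the two adjacent edges, and a random
  \<open>u\<close> does so with probability (exterior angle) / \<open>\<pi>\<close>. Hence the total curvature is \<open>\<pi>\<close> times
  the average number of extrema. Let \<open>p\<close> be a point of the \<open>n\<close>th hull and take ever finer inscribed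
  polygons. If for some \<open>u\<close> infinitely many of them had fewer than \<open>2n\<close> extrema, hence at most
  \<open>2n - 2\<close>, then a limit of the positions of these extrema would split the curve into at most
  \<open>2n - 1\<close> arcs on which \<open>u\<close> is monotone. Such an arc meets at most one component of the
  intersection with the plane through \<open>p\<close> orthogonal to \<open>u\<close>, and a component with the same side
  before and after it meets at least two arcs, so that this plane would be cut at most \<open>2n - 1\<close>
  times. Fatou's lemma then gives the average number of extrema a lower bound of \<open>2n\<close> in the limit.
\<close>

lemma nondecreasing_upto:
  fixes t :: "nat \<Rightarrow> real"
  assumes "\<And>i. i < N \<Longrightarrow> t i \<le> t (Suc i)" "i \<le> j" "j \<le> N"
  shows "t i \<le> t j"
  using assms(2,3)
proof (induction rule: dec_induct)
  case (step k)
  then show ?case using assms(1)[of k] by simp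
qed simp

lemma partition_covers:
  fixes \<tau> :: "nat \<Rightarrow> real"
  assumes "\<tau> 0 \<le> t" "t \<le> \<tau> M" "0 < M"
  shows "\<exists>i<M. \<tau> i \<le> t \<and> t \<le> \<tau> (Suc i)"
  using assms(2,3)
proof (induction M)
  case (Suc M)
  show ?case
  proof (cases "M > 0 \<and> t \<le> \<tau> M")
    case True
    then show ?thesis using Suc.IH by (meson less_Suc_eq)
  next
    case False
    then show ?thesis using Suc.prems assms(1) by (intro exI[of _ M]) auto
  qed
qed simp

lemma pred_mod_eq:
  fixes i l :: nat
  assumes "1 \<le> i" "i < l"
  shows "(i + l - 1) mod l = i - 1"
proof -
  have "i + l - 1 = (i - 1) + l" using assms by simp
  then show ?thesis using assms by (simp only: mod_add_self2 mod_less)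
qed

subsection \<open>The measure of directions separating two vectors\<close>

text \<open>The directions whose orthogonal hyperplane separates \<open>a\<close> from
  \<open>b\<close>. The sign condition is invariant under positive scaling of \<open>u\<close>, so
  Lebesgue measure on the unit ball can replace surface measure on the sphere.\<close>

definition crossing_set :: "'a::euclidean_space \<Rightarrow> 'a \<Rightarrow> 'a set" where
  "crossing_set a b = {u \<in> ball 0 1. (u \<bullet> a) * (u \<bullet> b) < 0}"

lemma open_crossing_set: "open (crossing_set a b)"
proof -
  have "open {u. (u \<bullet> a) * (u \<bullet> b) < 0}"
    by (intro open_Collect_less continuous_intros)
  moreover have "crossing_set a b = ball 0 1 \<inter> {u. (u \<bullet> a) * (u \<bullet> b) < 0}"
    by (auto simp: crossing_set_def)
  ultimately show ?thesis by (simp add: open_Int)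
qed

lemma lmeasurable_crossing_set: "crossing_set a b \<in> lmeasurable"
  by (rule lmeasurable_open[OF _ open_crossing_set])
     (auto simp: crossing_set_def intro: bounded_subset[of "ball 0 1"])

text \<open>If \<open>u\<close> has opposite signs on \<open>a\<close> and \<open>c\<close>, then
  its sign on \<open>b\<close> differs from one of them, unless \<open>u\<close> is orthogonal to
  \<open>b\<close>. Such \<open>u\<close> lie in a hyperplane, which is negligible.\<close>

lemma measure_crossing_set_subadd:
  assumes "b \<noteq> 0"
  shows "measure lebesgue (crossing_set a c)
    \<le> measure lebesgue (crossing_set a b) + measure lebesgue (crossing_set b c)"
proof -
  have neg: "negligible {u. b \<bullet> u = 0}"
    using assms by (intro negligible_hyperplane) auto
  let ?N = "{u. b \<bullet> u = 0} \<inter> ball 0 1"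
  have N: "negligible ?N"
    by (rule negligible_subset[OF neg]) auto
  have "crossing_set a c \<subseteq> (crossing_set a b \<union> crossing_set b c) \<union> ?N"
    unfolding crossing_set_def
    by (auto simp: inner_commute mult_less_0_iff)
  then have "measure lebesgue (crossing_set a c)
      \<le> measure lebesgue ((crossing_set a b \<union> crossing_set b c) \<union> ?N)"
    using N by (intro measure_mono_fmeasurable fmeasurable.Un lmeasurable_crossing_set)
      (auto simp: lmeasurable_crossing_set fmeasurableD negligible_iff_measure)
  also have "\<dots> \<le> measure lebesgue (crossing_set a b \<union> crossing_set b c) + measure lebesgue ?N"
    using N by (intro measure_Un_le)
      (auto simp: lmeasurable_crossing_set fmeasurableD negligible_iff_measure fmeasurable.Un)
  also have "measure lebesgue ?N = 0"
    using N by (simp add: negligible_iff_measure)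
  also have "measure lebesgue (crossing_set a b \<union> crossing_set b c)
     \<le> measure lebesgue (crossing_set a b) + measure lebesgue (crossing_set b c)"
    by (intro measure_Un_le) (auto simp: lmeasurable_crossing_set fmeasurableD)
  finally show ?thesis by simp
qed

text \<open>Polar coordinates in the plane of two vectors: \<open>circ t\<close> is the unit vector
  at angle \<open>t\<close> from \<open>e1\<close>, so angles become differences of
  parameters.\<close>

locale orthonormal_pair =
  fixes e1 e2 :: "real ^ 'n::{finite,wellorder}"
  assumes e11: "e1 \<bullet> e1 = 1" and e22: "e2 \<bullet> e2 = 1" and e12: "e1 \<bullet> e2 = 0"
begin

definition circ :: "real \<Rightarrow> (real, 'n) vec" where
  "circ t = cos t *\<^sub>R e1 + sin t *\<^sub>R e2"

text \<open>Rotation by \<open>s\<close> in the plane of \<open>e1\<close> and \<open>e2\<close>,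
  fixing its orthogonal complement. The two added terms are the changes of the coordinates of
  \<open>x\<close> along \<open>e1\<close> and \<open>e2\<close>.\<close>

definition rot :: "real \<Rightarrow> (real, 'n) vec \<Rightarrow> (real, 'n) vec" where
  "rot s x = x + ((cos s - 1) * (x \<bullet> e1) - sin s * (x \<bullet> e2)) *\<^sub>R e1
               + (sin s * (x \<bullet> e1) + (cos s - 1) * (x \<bullet> e2)) *\<^sub>R e2"

lemma e21: "e2 \<bullet> e1 = 0"
  using e12 by (simp add: inner_commute)

lemmas orthonormal = e11 e22 e12 e21

lemma circ_nonzero: "circ t \<noteq> 0"
proof
  assume "circ t = 0"
  then have "circ t \<bullet> e1 = 0" "circ t \<bullet> e2 = 0" by auto
  then have "cos t = 0" "sin t = 0"
    by (auto simp: circ_def inner_add_left orthonormal)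
  then show False using sin_cos_squared_add[of t] by simp
qed

lemma rot_circ: "rot s (circ t) = circ (t + s)"
proof -
  have "circ t \<bullet> e1 = cos t" "circ t \<bullet> e2 = sin t"
    by (auto simp: circ_def inner_add_left orthonormal)
  then show ?thesis
    by (simp add: rot_def circ_def cos_add sin_add algebra_simps flip: scaleR_left_distrib)
qed

lemma orthogonal_transformation_rot: "orthogonal_transformation (rot s)"
proof -
  have lin: "linear (rot s)"
    by (rule linearI) (simp_all add: rot_def inner_add_left algebra_simps)
  have "rot s v \<bullet> rot s w = v \<bullet> w" for v w
  proof -
    let ?c = "cos s" and ?s = "sin s"
    let ?p = "v \<bullet> e1" and ?q = "v \<bullet> e2" and ?p' = "w \<bullet> e1" and ?q' = "w \<bullet> e2"
    have cs: "?c * ?c + ?s * ?s = 1"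
      using sin_cos_squared_add[of s] by (simp add: power2_eq_square)
    have c: "e1 \<bullet> w = ?p'" "e2 \<bullet> w = ?q'" by (simp_all add: inner_commute)
    have "rot s v \<bullet> rot s w = v \<bullet> w
        + ((?c - 1) * ?p' - ?s * ?q') * ?p + (?s * ?p' + (?c - 1) * ?q') * ?q
        + ((?c - 1) * ?p - ?s * ?q) * ?p' + (?s * ?p + (?c - 1) * ?q) * ?q'
        + ((?c - 1) * ?p - ?s * ?q) * ((?c - 1) * ?p' - ?s * ?q')
        + (?s * ?p + (?c - 1) * ?q) * (?s * ?p' + (?c - 1) * ?q')"
      by (simp add: rot_def inner_add_left inner_add_right orthonormal c) (simp add: algebra_simps)
    also have "\<dots> = v \<bullet> w + (?c * ?c + ?s * ?s - 1) * (?p * ?p' + ?q * ?q')"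
      by (simp add: algebra_simps del: sin_cos_squared_add3)
    finally show ?thesis unfolding cs by simp
  qed
  with lin show ?thesis by (simp add: orthogonal_transformation_def)
qed

text \<open>The orthogonal map \<open>rot s\<close> carries one crossing set onto the other, so only
  the difference of the two angles matters.\<close>

lemma measure_crossing_set_circ:
  "measure lebesgue (crossing_set (circ (a + s)) (circ (b + s)))
    = measure lebesgue (crossing_set (circ a) (circ b))"
proof -
  have o: "orthogonal_transformation (rot s)" by (rule orthogonal_transformation_rot)
  have inn: "rot s v \<bullet> circ (t + s) = v \<bullet> circ t" for v t
    using o by (metis orthogonal_transformation_def rot_circ)
  have "crossing_set (circ (a + s)) (circ (b + s)) = rot s ` crossing_set (circ a) (circ b)"
  proof (intro equalityI subsetI)
    fix u assume u: "u \<in> crossing_set (circ (a + s)) (circ (b + s))"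
    obtain v where v: "u = rot s v"
      using orthogonal_transformation_surj[OF o] by (metis surjD)
    have "v \<in> crossing_set (circ a) (circ b)"
      using u unfolding v crossing_set_def
      by (auto simp: inn orthogonal_transformation_norm[OF o])
    then show "u \<in> rot s ` crossing_set (circ a) (circ b)" using v by auto
  next
    fix u assume "u \<in> rot s ` crossing_set (circ a) (circ b)"
    then show "u \<in> crossing_set (circ (a + s)) (circ (b + s))"
      unfolding crossing_set_def
      by (auto simp: inn orthogonal_transformation_norm[OF o])
  qed
  then show ?thesis
    by (simp add: measure_orthogonal_image[OF o lmeasurable_crossing_set])
qed

lemma crossing_set_circ_zero:
  assumes "u \<in> crossing_set (circ a) (circ b)" "a \<le> b"
  obtains t where "a < t" "t < b" "u \<bullet> circ t = 0"
proof -
  have cont: "continuous_on {a..b} (\<lambda>t. u \<bullet> circ t)"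
    unfolding circ_def by (intro continuous_intros)
  have neg: "(u \<bullet> circ a) * (u \<bullet> circ b) < 0"
    using assms by (auto simp: crossing_set_def)
  obtain t where t: "a \<le> t" "t \<le> b" "u \<bullet> circ t = 0"
  proof (cases "u \<bullet> circ a < 0")
    case True
    then show ?thesis using neg that IVT'[of "\<lambda>t. u \<bullet> circ t" a 0 b] cont assms(2)
      by (force simp: mult_less_0_iff)
  next
    case False
    then show ?thesis using neg that IVT2'[of "\<lambda>t. u \<bullet> circ t" b 0 a] cont assms(2)
      by (force simp: mult_less_0_iff)
  qed
  moreover have "t \<noteq> a" "t \<noteq> b" using neg t by auto
  ultimately show ?thesis using that by force
qed

text \<open>A common element would be orthogonal to \<open>circ t\<close> and \<open>circ t'\<close>
  for two distinct angles less than \<pi> apart. These span the plane, so it would be orthogonal to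
  the whole plane and could separate nothing in it.\<close>

lemma crossing_set_circ_disjoint:
  assumes "0 \<le> a" "a \<le> b" "b \<le> a'" "a' \<le> b'" "b' \<le> pi"
  shows "crossing_set (circ a) (circ b) \<inter> crossing_set (circ a') (circ b') = {}"
proof (rule ccontr)
  assume "\<not> ?thesis"
  then obtain u where u: "u \<in> crossing_set (circ a) (circ b)" "u \<in> crossing_set (circ a') (circ b')"
    by auto
  obtain t where t: "a < t" "t < b" "u \<bullet> circ t = 0"
    using crossing_set_circ_zero[OF u(1)] assms by metis
  obtain t' where t': "a' < t'" "t' < b'" "u \<bullet> circ t' = 0"
    using crossing_set_circ_zero[OF u(2)] assms by metis
  define p q where "p = u \<bullet> e1" and "q = u \<bullet> e2"
  have circ: "u \<bullet> circ r = cos r * p + sin r * q" for r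
    by (simp add: circ_def p_def q_def inner_add_right)
  have "sin (t' - t) > 0"
    using t t' assms by (intro sin_gt_zero) auto
  \<comment> \<open>Cramer's rule: \<open>p\<close> and \<open>q\<close> solve a homogeneous 2 by 2
    system with determinant \<open>sin (t' - t)\<close>.\<close>
  moreover have "sin (t' - t) * p = 0"
  proof -
    have "sin (t' - t) * p = sin t' * (cos t * p + sin t * q) - sin t * (cos t' * p + sin t' * q)"
      by (simp add: sin_diff algebra_simps)
    then show ?thesis using t(3) t'(3) circ by simp
  qed
  moreover have "sin (t' - t) * q = 0"
  proof -
    have "sin (t' - t) * q = cos t * (cos t' * p + sin t' * q) - cos t' * (cos t * p + sin t * q)"
      by (simp add: sin_diff algebra_simps)
    then show ?thesis using t(3) t'(3) circ by simp
  qed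
  ultimately have "p = 0" "q = 0" by auto
  with u show False by (auto simp: crossing_set_def circ)
qed

text \<open>\<open>M\<close> consecutive arcs of length \<open>d\<close> starting at angle 0 stay
  within \<open>[0, pi]\<close>. Their crossing sets are disjoint subsets of the ball, and all are
  rotated copies of the first.\<close>

lemma card_mult_measure_crossing_set_le:
  assumes "0 \<le> d" "real M * d \<le> pi"
  shows "real M * measure lebesgue (crossing_set (circ 0) (circ d))
    \<le> measure lebesgue (ball (0::(real,'n) vec) 1)"
proof -
  define A where "A k = crossing_set (circ (real k * d)) (circ (d + real k * d))" for k :: nat
  have "disjoint_family_on A {..<M}"
    unfolding disjoint_family_on_def
  proof (intro ballI impI)
    have *: "A i \<inter> A j = {}" if "i < j" "j < M" for i j
    proof -
      have "real (Suc i) * d \<le> real j * d" "real (Suc j) * d \<le> real M * d"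
        using that assms by (auto intro!: mult_right_mono)
      then show ?thesis unfolding A_def
        using assms by (intro crossing_set_circ_disjoint) (auto simp: algebra_simps)
    qed
    fix i j assume "i \<in> {..<M}" "j \<in> {..<M}" "i \<noteq> j"
    then show "A i \<inter> A j = {}" using *[of i j] *[of j i] by (cases "i < j") auto
  qed
  moreover have A: "A k \<in> lmeasurable" for k by (simp add: A_def lmeasurable_crossing_set)
  ultimately have "measure lebesgue (\<Union>k<M. A k) = (\<Sum>k<M. measure lebesgue (A k))"
    by (intro measure_finite_Union) (use fmeasurableD2[OF A] in \<open>auto simp: fmeasurableD\<close>)
  moreover have "measure lebesgue (A k) = measure lebesgue (crossing_set (circ 0) (circ d))" for k
    using measure_crossing_set_circ[of 0 "real k * d" d] by (simp add: A_def)
  moreover have "measure lebesgue (\<Union>k<M. A k) \<le> measure lebesgue (ball (0::(real,'n) vec) 1)"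
    using A by (intro measure_mono_fmeasurable)
       (auto simp: A_def crossing_set_def fmeasurableD)
  ultimately show ?thesis by simp
qed

text \<open>Subadditivity at the intermediate directions \<open>circ (real N * d)\<close>; every
  piece is a rotated copy of the first.\<close>

lemma measure_crossing_set_circ_mult:
  "measure lebesgue (crossing_set (circ 0) (circ (real N * d)))
    \<le> real N * measure lebesgue (crossing_set (circ 0) (circ d))"
proof (induction N)
  case 0
  have "crossing_set (circ 0) (circ 0) = {}"
    by (auto simp: crossing_set_def not_less)
  then show ?case by simp
next
  case (Suc N)
  have "measure lebesgue (crossing_set (circ 0) (circ (real (Suc N) * d)))
    \<le> measure lebesgue (crossing_set (circ 0) (circ (real N * d)))
     + measure lebesgue (crossing_set (circ (real N * d)) (circ (real (Suc N) * d)))"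
    by (rule measure_crossing_set_subadd[OF circ_nonzero])
  also have "measure lebesgue (crossing_set (circ (real N * d)) (circ (real (Suc N) * d)))
     = measure lebesgue (crossing_set (circ 0) (circ d))"
    using measure_crossing_set_circ[of 0 "real N * d" d] by (simp add: algebra_simps)
  finally show ?case using Suc by (simp add: algebra_simps)
qed

text \<open>Cut the angle \<open>x\<close> into \<open>N\<close> pieces of size \<open>d\<close>; about \<open>\<pi>/d\<close> rotated copies of the
  crossing set of one piece fit disjointly into the ball. Then let \<open>N\<close> tend to infinity.\<close>
lemma measure_crossing_set_circ_le:
  assumes "0 \<le> x" "x \<le> pi"
  shows "pi * measure lebesgue (crossing_set (circ 0) (circ x))
    \<le> x * measure lebesgue (ball (0::(real,'n) vec) 1)"
proof (cases "x = 0")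
  case True
  have "crossing_set (circ 0) (circ 0) = {}"
    by (auto simp: crossing_set_def not_less)
  then show ?thesis using True by simp
next
  case False
  with assms have x: "x > 0" by simp
  define g where "g = measure lebesgue (crossing_set (circ 0) (circ x))"
  define m where "m = measure lebesgue (ball (0::(real,'n) vec) 1)"
  have g: "g \<ge> 0" by (simp add: g_def)
  have *: "(pi / x - 1 / real (Suc k)) * g \<le> m" for k
  proof -
    define N where "N = Suc k"
    have N: "N > 0" by (simp add: N_def)
    define d where "d = x / real N"
    \<comment> \<open>Rounding down loses at most one copy. As \<open>pi / d\<close> is
      \<open>N\<close> times \<open>pi / x\<close>, this loss shrinks to \<open>1 / N\<close> after
      division by \<open>N\<close>.\<close>
    define M where "M = nat \<lfloor>pi / d\<rfloor>"
    have d: "d > 0" using x N by (simp add: d_def)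
    have pd: "pi / d \<ge> 0" using d by simp
    have M1: "real M \<le> pi / d" using pd by (simp add: M_def)
    have M2: "pi / d - 1 \<le> real M" using pd by (simp add: M_def)
    have gN: "g \<le> real N * measure lebesgue (crossing_set (circ 0) (circ d))"
      using measure_crossing_set_circ_mult[of N d] N by (simp add: g_def d_def)
    have "real M * d \<le> pi" using M1 d by (simp add: field_simps)
    then have Mm: "real M * measure lebesgue (crossing_set (circ 0) (circ d)) \<le> m"
      using card_mult_measure_crossing_set_le[of d M] d by (simp add: m_def)
    have "(pi / d - 1) * g \<le> real M * g" using M2 g by (rule mult_right_mono)
    also have "\<dots> \<le> real M * (real N * measure lebesgue (crossing_set (circ 0) (circ d)))"
      using gN by (intro mult_left_mono) auto
    also have "\<dots> = real N * (real M * measure lebesgue (crossing_set (circ 0) (circ d)))"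
      by simp
    also have "\<dots> \<le> real N * m" using Mm by (intro mult_left_mono) auto
    finally have "(pi / d - 1) * g / real N \<le> m" using N by (simp add: field_simps)
    moreover have "(pi / d - 1) * g / real N = (pi / x - 1 / real N) * g"
      using N x by (simp add: d_def field_simps)
    ultimately show ?thesis by (simp add: N_def)
  qed
  have "(\<lambda>k. (pi / x - 1 / real (Suc k)) * g) \<longlonglongrightarrow> (pi / x - 0) * g"
    by (intro tendsto_intros LIMSEQ_Suc[OF lim_1_over_n])
  then have "(pi / x - 0) * g \<le> m"
    using * by (intro LIMSEQ_le_const2) auto
  then show ?thesis using x by (simp add: g_def m_def field_simps)
qed

end

lemma crossing_set_scaleR:
  assumes "r > 0" "s > 0"
  shows "crossing_set (r *\<^sub>R a) (s *\<^sub>R b) = crossing_set a b"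
  using assms by (auto simp: crossing_set_def mult_less_0_iff zero_less_mult_iff)

text \<open>Normalize both vectors and place them at angles 0 and \<open>x\<close>, the exterior
  angle, in the plane they span. An upper bound suffices, because the curvature is to be bounded
  from below.\<close>

lemma measure_crossing_set_le:
  fixes a b :: "real ^ 'n::{finite,wellorder}"
  assumes "a \<noteq> 0" "b \<noteq> 0"
  shows "pi * measure lebesgue (crossing_set a b)
    \<le> exterior_angle a b * measure lebesgue (ball (0::(real,'n) vec) 1)"
proof -
  define a' b' where "a' = a /\<^sub>R norm a" and "b' = b /\<^sub>R norm b"
  have aa: "a' \<bullet> a' = 1" and bb: "b' \<bullet> b' = 1"
    using assms by (auto simp: a'_def b'_def dot_square_norm power2_eq_square)
  have ab: "a = norm a *\<^sub>R a'" "b = norm b *\<^sub>R b'"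
    using assms by (auto simp: a'_def b'_def)
  have "crossing_set (norm a *\<^sub>R a') (norm b *\<^sub>R b') = crossing_set a' b'"
    using assms by (intro crossing_set_scaleR) auto
  then have cs: "crossing_set a b = crossing_set a' b'" by (simp flip: ab)
  define c where "c = a' \<bullet> b'"
  have c: "a \<bullet> b / (norm a * norm b) = c"
    using assms by (simp add: c_def a'_def b'_def field_simps)
  have c1: "\<bar>c\<bar> \<le> 1"
    using Cauchy_Schwarz_ineq2[of a' b'] aa bb by (simp add: c_def norm_eq_sqrt_inner)
  define x where "x = arccos c"
  have x: "exterior_angle a b = x" by (simp add: exterior_angle_def c x_def)
  have bound: "measure lebesgue (crossing_set a b) \<le> measure lebesgue (ball (0::(real,'n) vec) 1)"
    by (intro measure_mono_fmeasurable)
       (auto simp: crossing_set_def[of a b] fmeasurableD lmeasurable_crossing_set[unfolded crossing_set_def])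
  \<comment> \<open>Parallel vectors span no plane: for \<open>c = 1\<close> nothing separates them,
    and for \<open>c = -1\<close> the angle is \<pi> and the claim is the trivial bound by the whole
    ball.\<close>
  consider "c = 1" | "c = -1" | "\<bar>c\<bar> < 1" using c1 by linarith
  then show ?thesis
  proof cases
    case 1
    have "(a' - b') \<bullet> (a' - b') = 0"
      using aa bb 1 by (simp add: inner_diff_left inner_diff_right c_def inner_commute)
    then have "a' = b'" by simp
    then have "crossing_set a b = {}"
      unfolding cs by (auto simp: crossing_set_def not_less)
    then show ?thesis using x 1 by (simp add: x_def)
  next
    case 2
    then show ?thesis using bound x by (simp add: x_def)
  next
    case 3
    have cos: "cos x = c" using c1 by (simp add: x_def)
    have sin: "sin x > 0"
      unfolding x_def using 3 by (intro sin_gt_zero arccos_lt_bounded[THEN conjunct1] arccos_lt_bounded[THEN conjunct2]) auto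
    have sc: "sin x * sin x = 1 - c * c"
      using sin_cos_squared_add[of x] cos by (simp add: power2_eq_square)
    \<comment> \<open>Gram-Schmidt; \<open>sin x\<close> is the norm of
      \<open>b' - c *\<^sub>R a'\<close>.\<close>
    define e2 where "e2 = (b' - c *\<^sub>R a') /\<^sub>R sin x"
    have e2b: "sin x *\<^sub>R e2 = b' - c *\<^sub>R a'" using sin by (simp add: e2_def)
    have "orthonormal_pair a' e2"
    proof
      show "a' \<bullet> a' = 1" by (rule aa)
      show "a' \<bullet> e2 = 0" by (simp add: e2_def inner_diff_right aa flip: c_def)
      have "(b' - c *\<^sub>R a') \<bullet> (b' - c *\<^sub>R a') = 1 - c * c"
        using aa bb by (simp add: inner_diff_left inner_diff_right inner_commute c_def)
      then show "e2 \<bullet> e2 = 1"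
        using sin by (simp add: e2_def divide_simps flip: sc)
    qed
    then interpret orthonormal_pair a' e2 .
    have "circ 0 = a'" "circ x = b'"
      by (simp_all add: circ_def e2b cos)
    then show ?thesis
      using measure_crossing_set_circ_le[of x] arccos_bounded[of c] c1 x cs by (auto simp: x_def)
  qed
qed

subsection \<open>Cuts and monotone arcs\<close>

lemma cis_minus_multiple_2pi: "cis (x - 2 * pi * real_of_int k) = cis x"
  by (simp add: cis_divide[symmetric])

text \<open>Shifting by whole periods moves the starting angle into \<open>[0, 2 * pi)\<close>,
  where the partitions live. The end \<open>b\<close> may still lie beyond
  \<open>2 * pi\<close>.\<close>

lemma same_side_component_normalized:
  assumes "same_side_component K u c C"
  obtains a b e where "0 \<le> a" "a < 2 * pi" "a \<le> b" "b < a + 2 * pi" "C = cis ` {a..b}" "e > 0"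
    "(\<forall>t \<in> {a-e<..<a} \<union> {b<..<b+e}. K (cis t) \<in> above u c) \<or>
     (\<forall>t \<in> {a-e<..<a} \<union> {b<..<b+e}. K (cis t) \<in> below u c)"
proof -
  obtain a b e where *: "a \<le> b" "b < a + 2 * pi" "C = cis ` {a..b}" "e > 0"
    "(\<forall>t \<in> {a-e<..<a} \<union> {b<..<b+e}. K (cis t) \<in> above u c) \<or>
     (\<forall>t \<in> {a-e<..<a} \<union> {b<..<b+e}. K (cis t) \<in> below u c)"
    using assms unfolding same_side_component_def by blast
  define k where "k = \<lfloor>a / (2 * pi)\<rfloor>"
  define r where "r = 2 * pi * real_of_int k"
  have cis: "cis (x - r) = cis x" for x by (simp add: r_def cis_minus_multiple_2pi)
  have cis': "cis (x + r) = cis x" for x using cis[of "x + r"] by simp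
  have "real_of_int k \<le> a / (2 * pi)" "a / (2 * pi) < real_of_int k + 1"
    unfolding k_def by linarith+
  then have r: "0 \<le> a - r" "a - r < 2 * pi"
    by (auto simp: r_def field_simps)
  have img: "C = cis ` {a - r..b - r}"
  proof -
    have "{a - r..b - r} = (\<lambda>x. x - r) ` {a..b}"
      by (auto simp: image_iff intro!: bexI[of _ "_ + r"])
    then show ?thesis unfolding *(3) by (simp only: image_image cis)
  qed
  have side: "\<forall>t \<in> {a-r-e<..<a-r} \<union> {b-r<..<b-r+e}. K (cis t) \<in> S"
    if "\<forall>t \<in> {a-e<..<a} \<union> {b<..<b+e}. K (cis t) \<in> S" for S
  proof
    fix t assume "t \<in> {a-r-e<..<a-r} \<union> {b-r<..<b-r+e}"
    then have "t + r \<in> {a-e<..<a} \<union> {b<..<b+e}" by auto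
    with that have "K (cis (t + r)) \<in> S" by blast
    then show "K (cis t) \<in> S" by (simp add: cis')
  qed
  show ?thesis
  proof (rule that[OF r _ _ img *(4)])
    show "(\<forall>t \<in> {a-r-e<..<a-r} \<union> {b-r<..<b-r+e}. K (cis t) \<in> above u c) \<or>
      (\<forall>t \<in> {a-r-e<..<a-r} \<union> {b-r<..<b-r+e}. K (cis t) \<in> below u c)"
      using *(5) side[of "above u c"] side[of "below u c"] by blast
  qed (use *(1,2) in auto)
qed

text \<open>Let \<open>I C\<close> be the set of closed arcs that meet the component
  \<open>C\<close>. These sets are nonempty and pairwise disjoint, and have at least two elements if
  the curve stays on the same side. So the weights of the components add up to at most the number of
  arcs.\<close>

lemma cuts_le_monotone_arcs:
  fixes K :: "complex \<Rightarrow> 'a::euclidean_space"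
  assumes M: "2 \<le> M" and ends: "\<tau> 0 = 0" "\<tau> M = 2 * pi"
    and incr: "\<And>i. i < M \<Longrightarrow> \<tau> i \<le> \<tau> (Suc i)"
    and mono: "\<And>i. i < M \<Longrightarrow> mono_on {\<tau> i..\<tau> (Suc i)} (\<lambda>t. u \<bullet> K (cis t))
                 \<or> antimono_on {\<tau> i..\<tau> (Suc i)} (\<lambda>t. u \<bullet> K (cis t))"
    and notin: "\<not> K ` sphere 0 1 \<subseteq> hyperplane u c"
  shows "cuts K u c \<le> enat M"
proof -
  define f where "f t = u \<bullet> K (cis t)" for t
  have mono: "(\<forall>s t. \<tau> i \<le> s \<and> s \<le> t \<and> t \<le> \<tau> (Suc i) \<longrightarrow> f s \<le> f t) \<or>
              (\<forall>s t. \<tau> i \<le> s \<and> s \<le> t \<and> t \<le> \<tau> (Suc i) \<longrightarrow> f t \<le> f s)" if "i < M" for i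
    using mono[OF that] unfolding f_def monotone_on_def by auto
  define Z where "Z = {z \<in> sphere 0 1. K z \<in> hyperplane u c}"
  define I where "I C = {i. i < M \<and> C \<inter> cis ` {\<tau> i..\<tau> (Suc i)} \<noteq> {}}" for C
  have fin: "finite (I C)" for C by (auto simp: I_def)
  have covers: "\<exists>i<M. \<tau> i \<le> t \<and> t \<le> \<tau> (Suc i)" if "0 \<le> t" "t \<le> 2 * pi" for t
    using partition_covers[of \<tau> t M] that ends M by auto
  have IC: "i \<in> I C" if "i < M" "\<tau> i \<le> t" "t \<le> \<tau> (Suc i)" "cis t \<in> C" for i t C
    using that by (auto simp: I_def)
  have fZ: "f t = c" if "cis t \<in> Z" for t
    using that by (auto simp: Z_def f_def hyperplane_def)
  have ne: "I C \<noteq> {}" if C: "C \<in> components Z" for C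
  proof -
    obtain z where z: "z \<in> C" using in_components_nonempty[OF C] by blast
    then have "norm z = 1" using in_components_subset[OF C] by (auto simp: Z_def)
    then have "cis (Arg2pi z) = z"
      by (simp add: complex_norm_eq_1_exp cis_conv_exp)
    moreover obtain i where "i < M" "\<tau> i \<le> Arg2pi z" "Arg2pi z \<le> \<tau> (Suc i)"
      using covers[of "Arg2pi z"] Arg2pi_ge_0[of z] Arg2pi_lt_2pi[of z] by auto
    ultimately show ?thesis using IC z by fastforce
  qed
  \<comment> \<open>Two points with value \<open>c\<close> on a monotone arc force the value
    \<open>c\<close> between them, so a connected piece of \<open>Z\<close> joins them.\<close>
  have eq_aux: "C = C'" if C: "C \<in> components Z" "C' \<in> components Z" and i: "i < M"
    and s: "cis s \<in> C" and t: "cis t \<in> C'" and st: "\<tau> i \<le> s" "s \<le> t" "t \<le> \<tau> (Suc i)" for C C' i s t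
  proof -
    have fs: "f s = c" "f t = c" using s t in_components_subset[OF C(1)] in_components_subset[OF C(2)] fZ
      by auto
    have f: "f r = c" if "s \<le> r" "r \<le> t" for r
      using mono[OF i] fs that st by (smt (verit))
    have "connected (cis ` {s..t})"
      by (intro connected_continuous_image continuous_intros) auto
    moreover have "cis ` {s..t} \<subseteq> Z"
      using f by (auto simp: Z_def f_def hyperplane_def)
    moreover have "C \<inter> cis ` {s..t} \<noteq> {}" using s st by auto
    ultimately have "cis ` {s..t} \<subseteq> C" using components_maximal[OF C(1)] by blast
    then have "cis t \<in> C" using st by auto
    then show ?thesis using components_nonoverlap[OF C] t by auto
  qed
  have disj: "C = C'" if C: "C \<in> components Z" "C' \<in> components Z" and iI: "i \<in> I C" "i \<in> I C'" for C C' i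
  proof -
    obtain s t where st: "cis s \<in> C" "cis t \<in> C'" "s \<in> {\<tau> i..\<tau> (Suc i)}" "t \<in> {\<tau> i..\<tau> (Suc i)}" and i: "i < M"
      using iI unfolding I_def by blast
    show ?thesis
    proof (cases "s \<le> t")
      case True
      then show ?thesis using eq_aux[of C C' i s t] C i st by auto
    next
      case False
      then show ?thesis using eq_aux[of C' C i t s] C i st by auto
    qed
  qed
  have two: "2 \<le> card (I C)" if C: "C \<in> components Z" and same: "same_side_component K u c C" for C
  proof (rule ccontr)
    assume "\<not> 2 \<le> card (I C)"
    then have uniq: "i = j" if "i \<in> I C" "j \<in> I C" for i j
      using that fin[of C] by (metis card_le_Suc0_iff_eq not_less_eq_eq numeral_2_eq_2)
    obtain a b e where ab: "0 \<le> a" "a < 2 * pi" "a \<le> b" "b < a + 2 * pi" "C = cis ` {a..b}" "e > 0"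
      and sides: "(\<forall>t \<in> {a-e<..<a} \<union> {b<..<b+e}. K (cis t) \<in> above u c) \<or>
        (\<forall>t \<in> {a-e<..<a} \<union> {b<..<b+e}. K (cis t) \<in> below u c)"
      using same_side_component_normalized[OF same] by metis
    have inC: "cis t \<in> C" if "a \<le> t" "t \<le> b" for t using that ab by auto
    have aC: "cis a \<in> C" and bC: "cis b \<in> C" using inC ab(3) by auto
    then have "cis a \<in> Z" "cis b \<in> Z" using in_components_subset[OF C] by auto
    then have fa: "f a = c" and fb: "f b = c" by (auto intro: fZ)

    \<comment> \<open>The point 1 is the start of the first arc and the end of the last one, and
      these differ since \<open>2 \<le> M\<close>. A component meeting only one arc therefore avoids
      1, which confines \<open>{a..b}\<close> to the open interval from 0 to
      \<open>2 * pi\<close>.\<close>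
    have first: "0 \<in> I C" if "1 \<in> C"
      using IC[of 0 0 C] that M ends incr[of 0] by auto
    have last: "M - 1 \<in> I C" if "1 \<in> C"
      using IC[of "M - 1" "2 * pi" C] that M ends incr[of "M - 1"] by auto
    have not1: "1 \<notin> C"
      using first last uniq[of 0 "M - 1"] M by auto
    have "a \<noteq> 0" using not1 aC by auto
    with ab(1) have a: "0 < a" by simp
    have b: "b < 2 * pi" using not1 inC[of "2 * pi"] ab(2) by (auto simp: not_le[symmetric])
    obtain i where i: "i < M" "\<tau> i \<le> a" "a \<le> \<tau> (Suc i)" using covers[of a] a ab(2) by auto
    obtain j where j: "j < M" "\<tau> j \<le> b" "b \<le> \<tau> (Suc j)" using covers[of b] a b ab(3) by auto
    have iI: "i \<in> I C" using IC[OF i aC] .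
    have jI: "j \<in> I C" using IC[OF j bC] .
    have [simp]: "j = i" using iI jI uniq by blast
    \<comment> \<open>An endpoint of \<open>C\<close> at a division point would make
      \<open>C\<close> meet the neighbouring arc too. So arc \<open>i\<close> extends beyond
      \<open>C\<close> on both sides.\<close>
    have "\<tau> i \<noteq> a"
    proof
      assume eq: "\<tau> i = a"
      then have "i > 0" using a ends by (cases i) auto
      then have "i - 1 \<in> I C"
        using IC[of "i - 1" a C] eq i aC incr[of "i - 1"] by auto
      then show False using uniq[OF iI, of "i - 1"] \<open>i > 0\<close> by simp
    qed
    then have ia: "\<tau> i < a" using i by simp
    have "\<tau> (Suc i) \<noteq> b"
    proof
      assume eq: "\<tau> (Suc i) = b"
      then have "Suc i < M" using b ends i by (metis Suc_lessI less_irrefl)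
      then have "Suc i \<in> I C"
        using IC[of "Suc i" b C] eq bC incr[of "Suc i"] by auto
      then show False using uniq[OF iI, of "Suc i"] by simp
    qed
    then have ib: "b < \<tau> (Suc i)" using j by simp
    \<comment> \<open>Sample points just before and just after \<open>C\<close>, within arc
      \<open>i\<close> and within distance \<open>e\<close> of \<open>C\<close>. Monotonicity puts
      their values on opposite sides of \<open>c\<close> in the weak sense, whereas both lie
      strictly on the same side.\<close>
    define s where "s = max (\<tau> i) (a - e / 2)"
    define t where "t = min (\<tau> (Suc i)) (b + e / 2)"
    have s: "s \<in> {a-e<..<a}" "\<tau> i \<le> s" using ia ab(6) by (auto simp: s_def)
    have t: "t \<in> {b<..<b+e}" "t \<le> \<tau> (Suc i)" using ib ab(6) by (auto simp: t_def)
    have "(f s > c \<and> f t > c) \<or> (f s < c \<and> f t < c)"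
      using sides s t by (auto simp: above_def below_def f_def)
    moreover have "(f s \<le> f a \<and> f b \<le> f t) \<or> (f a \<le> f s \<and> f t \<le> f b)"
      using mono[OF i(1)] s t ia ib ab(3) by auto
    ultimately show False using fa fb by linarith
  qed
  \<comment> \<open>Finiteness excludes the case in which \<open>cuts\<close> is infinite.\<close>
  have finZ: "finite (components Z)"
  proof (rule inj_on_finite)
    show "inj_on I (components Z)"
    proof (rule inj_onI)
      fix C C' assume "C \<in> components Z" "C' \<in> components Z" "I C = I C'"
      moreover from this obtain i where "i \<in> I C" using ne by auto
      ultimately show "C = C'" using disj[of C C' i] by auto
    qed
    show "I ` components Z \<subseteq> Pow {..<M}" by (auto simp: I_def)
  qed auto
  have weight: "(if same_side_component K u c C then 2 else 1) \<le> enat (card (I C))"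
    if C: "C \<in> components Z" for C
  proof -
    have "1 \<le> card (I C)" using ne[OF C] fin[of C] by (simp add: Suc_le_eq card_gt_0_iff)
    then show ?thesis using two[OF C]
      by (auto simp: one_enat_def numeral_eq_enat)
  qed
  have "cuts K u c = (\<Sum>C \<in> components Z. if same_side_component K u c C then 2 else 1)"
    using notin finZ by (simp add: cuts_def pullback_components_def Z_def)
  also have "\<dots> \<le> (\<Sum>C \<in> components Z. enat (card (I C)))"
    using weight by (intro sum_mono)
  also have "\<dots> = enat (\<Sum>C \<in> components Z. card (I C))"
    by (simp flip: of_nat_eq_enat)
  also have "(\<Sum>C \<in> components Z. card (I C)) = card (\<Union>C \<in> components Z. I C)"
    using disj by (intro card_UN_disjoint[symmetric] finZ ballI fin impI) blast
  also have "\<dots> \<le> card {..<M}"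
    by (intro card_mono) (auto simp: I_def)
  finally show ?thesis by simp
qed

subsection \<open>Sign changes of finite sequences\<close>

lemma card_sign_changes_Suc:
  fixes d :: "nat \<Rightarrow> real"
  shows "card {i \<in> {1..<Suc l}. d (i - 1) * d i < 0}
    = card {i \<in> {1..<l}. d (i - 1) * d i < 0} + (if l > 0 \<and> d (l - 1) * d l < 0 then 1 else 0)"
proof (cases "l > 0 \<and> d (l - 1) * d l < 0")
  case True
  then have "{i \<in> {1..<Suc l}. d (i - 1) * d i < 0} = insert l {i \<in> {1..<l}. d (i - 1) * d i < 0}"
    by (auto simp: less_Suc_eq)
  then show ?thesis using True by simp
next
  case False
  then have "{i \<in> {1..<Suc l}. d (i - 1) * d i < 0} = {i \<in> {1..<l}. d (i - 1) * d i < 0}"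
    by (auto simp: less_Suc_eq Suc_le_eq)
  then show ?thesis using False by (simp only:) auto
qed

text \<open>Each sign change opens a new block; any other new term extends the last one. Blocks may
  be empty, so the number \<open>N\<close> can be the same for all polygons, as the passage to the
  limit requires.\<close>

lemma constant_sign_blocks:
  fixes d :: "nat \<Rightarrow> real"
  assumes "\<forall>j<l. d j \<noteq> 0" "card {i \<in> {1..<l}. d (i - 1) * d i < 0} < N"
  shows "\<exists>b. b 0 = 0 \<and> b N = l \<and> (\<forall>i<N. b i \<le> b (Suc i)) \<and>
    (\<forall>i<N. (\<forall>j\<in>{b i..<b (Suc i)}. 0 < d j) \<or> (\<forall>j\<in>{b i..<b (Suc i)}. d j < 0))"
  using assms
proof (induction l arbitrary: N)
  case 0
  then show ?case by (intro exI[of _ "\<lambda>_. 0"]) auto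
next
  case (Suc l)
  define ch where "ch = (l > 0 \<and> d (l - 1) * d l < 0)"
  from Suc.prems(2) obtain N' where N: "N = Suc N'" by (cases N) auto
  show ?case
  proof (cases ch)
    case True
    then have "card {i \<in> {1..<l}. d (i - 1) * d i < 0} < N'"
      using Suc.prems(2) unfolding card_sign_changes_Suc N ch_def by simp
    from Suc.IH[OF _ this] Suc.prems(1) obtain b where b: "b 0 = 0" "b N' = l" "\<forall>i<N'. b i \<le> b (Suc i)"
      "\<forall>i<N'. (\<forall>j\<in>{b i..<b (Suc i)}. 0 < d j) \<or> (\<forall>j\<in>{b i..<b (Suc i)}. d j < 0)"
      by auto
    show ?thesis
    proof (intro exI[of _ "b(N := Suc l)"] conjI allI impI)
      fix i assume i: "i < N"
      show "(b(N := Suc l)) i \<le> (b(N := Suc l)) (Suc i)"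
        using i b N by (cases "i = N'") auto
      have "d l \<noteq> 0" "{l..<Suc l} = {l}" using Suc.prems(1) by auto
      then show "(\<forall>j\<in>{(b(N := Suc l)) i..<(b(N := Suc l)) (Suc i)}. 0 < d j) \<or>
            (\<forall>j\<in>{(b(N := Suc l)) i..<(b(N := Suc l)) (Suc i)}. d j < 0)"
        using i b N by (cases "i = N'") (simp_all, linarith)
    qed (use b N in auto)
  next
    case False
    then have "card {i \<in> {1..<l}. d (i - 1) * d i < 0} < N"
      using Suc.prems(2) unfolding card_sign_changes_Suc ch_def by simp
    from Suc.IH[OF _ this] Suc.prems(1) obtain b where b: "b 0 = 0" "b N = l" "\<forall>i<N. b i \<le> b (Suc i)"
      "\<forall>i<N. (\<forall>j\<in>{b i..<b (Suc i)}. 0 < d j) \<or> (\<forall>j\<in>{b i..<b (Suc i)}. d j < 0)"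
      by auto
    have dl: "d l \<noteq> 0" using Suc.prems(1) by auto
    have bl: "b N' \<le> l" using b N by (metis lessI)
    \<comment> \<open>A nonempty last block has the sign of \<open>d (l - 1)\<close>, which
      \<open>d l\<close> shares as there is no change; an empty one takes the sign of
      \<open>d l\<close>.\<close>
    have last: "(\<forall>j\<in>{b N'..<Suc l}. 0 < d j) \<or> (\<forall>j\<in>{b N'..<Suc l}. d j < 0)"
    proof (cases "b N' = l")
      case True
      then have "{b N'..<Suc l} = {l}" by auto
      then show ?thesis using dl by auto
    next
      case False
      with bl have l: "b N' < l" by simp
      have "l - 1 \<in> {b N'..<l}" using l by auto
      moreover have "(\<forall>j\<in>{b N'..<l}. 0 < d j) \<or> (\<forall>j\<in>{b N'..<l}. d j < 0)"
        using b N by (metis lessI)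
      moreover have "\<not> d (l - 1) * d l < 0" using \<open>\<not> ch\<close> l by (auto simp: ch_def)
      moreover have "{b N'..<Suc l} = insert l {b N'..<l}" using l by auto
      ultimately show ?thesis using dl by (auto simp: mult_less_0_iff)
    qed
    show ?thesis
    proof (intro exI[of _ "b(N := Suc l)"] conjI allI impI)
      fix i assume i: "i < N"
      show "(b(N := Suc l)) i \<le> (b(N := Suc l)) (Suc i)"
        using i b N bl by (cases "i = N'") auto
      show "(\<forall>j\<in>{(b(N := Suc l)) i..<(b(N := Suc l)) (Suc i)}. 0 < d j) \<or>
            (\<forall>j\<in>{(b(N := Suc l)) i..<(b(N := Suc l)) (Suc i)}. d j < 0)"
      proof (cases "i = N'")
        case True then show ?thesis using last N by simp
      next
        case False then show ?thesis using i b N by simp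
      qed
    qed (use b N in auto)
  qed
qed

text \<open>Every change flips the sign, so the parity of their number tells whether the first and
  the last term agree in sign.\<close>

lemma even_sign_changes_iff:
  fixes d :: "nat \<Rightarrow> real"
  assumes "\<forall>j<l. d j \<noteq> 0" "0 < l"
  shows "even (card {i \<in> {1..<l}. d (i - 1) * d i < 0}) \<longleftrightarrow> 0 < d (l - 1) * d 0"
  using assms
proof (induction l)
  case (Suc l)
  show ?case
  proof (cases "l = 0")
    case True
    then show ?thesis using Suc.prems by (auto simp: zero_less_mult_iff)
  next
    case False
    then have "even (card {i \<in> {1..<l}. d (i - 1) * d i < 0}) \<longleftrightarrow> 0 < d (l - 1) * d 0"
      using Suc by simp
    moreover have "d l \<noteq> 0" "d (l - 1) \<noteq> 0" "d 0 \<noteq> 0" using Suc.prems False by auto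
    ultimately show ?thesis unfolding card_sign_changes_Suc using False
      by (auto simp: zero_less_mult_iff mult_less_0_iff)
  qed
qed simp

text \<open>The number of sign changes around a cycle is even, so that fewer than \<open>2n\<close> of them
  are at most \<open>2n - 2\<close>.\<close>
lemma card_sign_changes_less_of_cyclic:
  fixes d :: "nat \<Rightarrow> real"
  assumes nz: "\<forall>j<l. d j \<noteq> 0" and l: "0 < l" and n: "0 < n"
    and E: "card {i. i < l \<and> d ((i + l - 1) mod l) * d i < 0} < 2 * n"
  shows "card {i \<in> {1..<l}. d (i - 1) * d i < 0} < 2 * n - 1"
proof -
  let ?A = "{i \<in> {1..<l}. d (i - 1) * d i < 0}"
  have "?A \<subseteq> {i. i < l \<and> d ((i + l - 1) mod l) * d i < 0}" using pred_mod_eq by auto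
  then have le: "card ?A \<le> card {i. i < l \<and> d ((i + l - 1) mod l) * d i < 0}"
    by (intro card_mono) auto
  show ?thesis
  proof (rule ccontr)
    assume "\<not> ?thesis"
    \<comment> \<open>With \<open>2 * n - 1\<close> changes, an odd number, the last and first terms
      have opposite signs. The closing step then contributes one more change at index 0, which makes
      \<open>2 * n\<close> of them.\<close>
    with le E n have eq: "card ?A = 2 * n - 1" by linarith
    then have "odd (card ?A)" using n by simp
    then have "d (l - 1) * d 0 < 0"
      using even_sign_changes_iff[OF nz l] nz l by (auto simp: not_less order_le_less)
    then have "insert 0 ?A \<subseteq> {i. i < l \<and> d ((i + l - 1) mod l) * d i < 0}" using l pred_mod_eq by auto
    then have "card (insert 0 ?A) \<le> card {i. i < l \<and> d ((i + l - 1) mod l) * d i < 0}"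
      by (intro card_mono) auto
    then show False using eq E n by simp
  qed
qed

subsection \<open>Approximation by inscribed polygons\<close>

text \<open>Inscribed polygons need distinct consecutive vertices. Among the partitions on whose parts
  every value is close to the value at one of the two endpoints, one with the fewest points has
  this property, since equal neighbours could be merged.\<close>
lemma fine_partition:
  fixes g :: "real \<Rightarrow> 'a::metric_space"
  assumes cont: "continuous_on {a..b} g" and ab: "a < b" and loop: "g a = g b"
    and nonconst: "s0 \<in> {a..b}" "g s0 \<noteq> g a" and e: "0 < e"
  obtains l t where "0 < l" "t 0 = a" "t l = b" "\<And>j. j < l \<Longrightarrow> t j < t (Suc j)"
    "\<And>j. j < l \<Longrightarrow> g (t j) \<noteq> g (t (Suc j))"
    "\<And>j s. j < l \<Longrightarrow> s \<in> {t j..t (Suc j)} \<Longrightarrow> dist (g s) (g (t j)) \<le> e"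
proof -
  \<comment> \<open>A third of \<open>e\<close>, since the final estimate adds up three distances of
    at most \<open>r\<close>. Being less than \<open>dist (g s0) (g a)\<close>, it also rules out a
    partition with a single part.\<close>
  define r where "r = min (e / 3) (dist (g s0) (g a) / 2)"
  have r: "r > 0" "3 * r \<le> e" "r < dist (g s0) (g a)"
    using e nonconst by (auto simp: r_def min_def)
  define P where "P l \<longleftrightarrow> (\<exists>t. t 0 = a \<and> t l = b \<and> (\<forall>j<l. t j < t (Suc j)) \<and>
    (\<forall>j<l. \<forall>s\<in>{t j..t (Suc j)}. dist (g s) (g (t j)) \<le> r \<or> dist (g s) (g (t (Suc j))) \<le> r))"
    for l :: nat
  have "\<exists>l. P l"
  proof -
    have "uniformly_continuous_on {a..b} g"
      using cont by (intro compact_uniformly_continuous) auto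
    then obtain \<delta> where \<delta>: "\<delta> > 0"
      "\<And>x y. x \<in> {a..b} \<Longrightarrow> y \<in> {a..b} \<Longrightarrow> dist x y < \<delta> \<Longrightarrow> dist (g x) (g y) < r"
      unfolding uniformly_continuous_on_def using r by metis
    obtain l :: nat where l: "(b - a) / \<delta> < real l" using reals_Archimedean2 by blast
    then have l0: "real l > 0" using \<delta> ab by (smt (verit) divide_pos_pos)
    have small: "(b - a) / l < \<delta>" using l l0 \<delta> by (simp add: field_simps)
    define t where "t j = a + (b - a) * real j / real l" for j
    have step: "t (Suc j) = t j + (b - a) / l" for j
      by (simp add: t_def add_divide_distrib distrib_left)
    have bd: "a \<le> t j" "j \<le> l \<Longrightarrow> t j \<le> b" for j
    proof -
      show "a \<le> t j" using ab by (simp add: t_def)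
      assume "j \<le> l"
      then have "real j / real l \<le> 1" using l0 by simp
      then have "(b - a) * (real j / real l) \<le> (b - a) * 1"
        using ab by (intro mult_left_mono) auto
      then show "t j \<le> b" by (simp add: t_def)
    qed
    have "P l" unfolding P_def
    proof (intro exI[of _ t] conjI allI impI ballI)
      show "t 0 = a" "t l = b" using l0 by (auto simp: t_def)
      show "t j < t (Suc j)" for j using ab l0 by (simp add: step)
      fix j s assume "j < l" "s \<in> {t j..t (Suc j)}"
      then have "dist (g s) (g (t j)) < r"
        using bd[of j] bd[of "Suc j"] small step[of j] by (intro \<delta>) (auto simp: dist_real_def)
      then show "dist (g s) (g (t j)) \<le> r \<or> dist (g s) (g (t (Suc j))) \<le> r" by simp
    qed
    then show ?thesis ..
  qed
  then obtain l where l: "P l" and least: "\<And>k. k < l \<Longrightarrow> \<not> P k"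
    by (metis exists_least_iff)
  from l obtain t where t: "t 0 = a" "t l = b" "\<And>j. j < l \<Longrightarrow> t j < t (Suc j)"
    and near: "\<And>j s. j < l \<Longrightarrow> t j \<le> s \<Longrightarrow> s \<le> t (Suc j) \<Longrightarrow> dist (g s) (g (t j)) \<le> r \<or> dist (g s) (g (t (Suc j))) \<le> r"
    unfolding P_def by (metis atLeastAtMost_iff)
  have l0: "0 < l" using t ab by (cases l) auto
  have ne: "g (t j) \<noteq> g (t (Suc j))" if j: "j < l" for j
  proof
    assume eq: "g (t j) = g (t (Suc j))"
    \<comment> \<open>With a single part, both endpoints have the value \<open>g a\<close>, from
      which \<open>g s0\<close> is too far away.\<close>
    have l1: "l \<noteq> 1"
    proof
      assume "l = 1"
      then have "dist (g s0) (g a) \<le> r" using near[of 0 s0] t nonconst loop by auto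
      then show False using r by simp
    qed
    \<comment> \<open>The division point to be dropped: \<open>t j\<close>, or \<open>t 1\<close> if
      \<open>j = 0\<close> because the endpoint \<open>a\<close> must stay. The other of the two
      equal neighbours survives, so closeness to an endpoint value is kept.\<close>
    define k where "k = (if j = 0 then 1 else j)"
    have k: "0 < k" "k < l" using j l0 l1 by (auto simp: k_def)
    define t' where "t' i = (if i < k then t i else t (Suc i))" for i
    have "P (l - 1)" unfolding P_def
    proof (intro exI[of _ t'] conjI allI impI ballI)
      show "t' 0 = a" "t' (l - 1) = b" using k t by (auto simp: t'_def)
      fix i assume i: "i < l - 1"
      consider "Suc i < k" | "Suc i = k" | "k \<le> i" by linarith
      then show "t' i < t' (Suc i)"
      proof cases
        case 2
        then have "t i < t (Suc i)" "t (Suc i) < t (Suc (Suc i))" using i t(3) by auto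
        then show ?thesis using 2 by (auto simp: t'_def)
      qed (use i t in \<open>auto simp: t'_def\<close>)
      fix s assume s: "s \<in> {t' i..t' (Suc i)}"
      consider "Suc i < k" | "Suc i = k" | "k \<le> i" by linarith
      then show "dist (g s) (g (t' i)) \<le> r \<or> dist (g s) (g (t' (Suc i))) \<le> r"
      proof cases
        case 2
        have il: "Suc i < l" using i by simp
        have st: "t i \<le> s" "s \<le> t (Suc (Suc i))" using s 2 by (auto simp: t'_def)
        have "g (t (Suc i)) = g (t i) \<or> g (t (Suc i)) = g (t (Suc (Suc i)))"
          using eq 2 by (auto simp: k_def split: if_splits)
        then show ?thesis
          using near[of i s] near[of "Suc i" s] st 2 il by (cases "s \<le> t (Suc i)") (auto simp: t'_def)
      qed (use i s near[of i s] near[of "Suc i" s] in \<open>auto simp: t'_def\<close>)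
    qed
    then show False using least l0 by auto
  qed
  have tb: "a \<le> t j" "t j \<le> b" if "j \<le> l" for j
  proof -
    from nondecreasing_upto[of l t, OF less_imp_le[OF t(3)]] that show "a \<le> t j" "t j \<le> b" using t by auto
  qed
  have close: "dist (g s) (g (t j)) \<le> e" if j: "j < l" and s: "s \<in> {t j..t (Suc j)}" for j s
  proof -
    let ?I = "{t j..t (Suc j)}"
    have cj: "continuous_on ?I g"
      using tb[of j] tb[of "Suc j"] j by (intro continuous_on_subset[OF cont]) auto
    have cl: "closed {s \<in> ?I. dist (g s) x \<le> r}" for x
    proof -
      have "closed (?I \<inter> (\<lambda>s. dist (g s) x) -` {..r})"
        by (intro continuous_closed_preimage continuous_intros cj)
      then show ?thesis by (simp add: Int_def vimage_def)
    qed
    \<comment> \<open>The points close to the left value and those close to the right value form two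
      nonempty closed sets covering a connected interval, so they meet.\<close>
    have "\<exists>s\<in>?I. dist (g s) (g (t j)) \<le> r \<and> dist (g s) (g (t (Suc j))) \<le> r"
    proof (rule ccontr)
      assume "\<not> ?thesis"
      then have "{s \<in> ?I. dist (g s) (g (t j)) \<le> r} \<inter> ?I = {} \<or> {s \<in> ?I. dist (g s) (g (t (Suc j))) \<le> r} \<inter> ?I = {}"
        using near[OF j] by (intro connected_closedD cl) (auto, blast)
      moreover have "t j \<in> ?I" "t (Suc j) \<in> ?I" using t(3)[OF j] by auto
      ultimately show False using r by fastforce
    qed
    then have "dist (g (t j)) (g (t (Suc j))) \<le> 2 * r"
      by (smt (verit) dist_commute dist_triangle)
    moreover have "dist (g s) (g (t j)) \<le> r \<or> dist (g s) (g (t (Suc j))) \<le> r"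
      using near[OF j] s by auto
    ultimately show ?thesis using r
      by (smt (verit) dist_commute dist_triangle)
  qed
  show ?thesis using that[of l t] l0 t ne close by auto
qed

text \<open>Replacing \<open>s\<close> and \<open>s'\<close> by the division points to their left
  changes each value by at most \<open>e\<close>, and at division points \<open>f\<close> is
  nondecreasing.\<close>

lemma approx_mono_block:
  fixes f :: "real \<Rightarrow> real"
  assumes e: "0 \<le> e" and incr: "\<And>j. j \<in> {p..<q} \<Longrightarrow> t j \<le> t (Suc j)"
    and up: "\<And>j. j \<in> {p..<q} \<Longrightarrow> f (t j) \<le> f (t (Suc j))"
    and near: "\<And>j s. j \<in> {p..<q} \<Longrightarrow> s \<in> {t j..t (Suc j)} \<Longrightarrow> \<bar>f s - f (t j)\<bar> \<le> e"
    and s: "p \<le> q" "t p \<le> s" "s \<le> s'" "s' \<le> t q"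
  shows "f s \<le> f s' + 2 * e"
\<comment> \<open>If \<open>s = s'\<close> is a division point, the parts chosen for the two might
  come in the wrong order.\<close>
proof (cases "s = s'")
  case True
  then show ?thesis using e by simp
next
  case False
  then have pq: "p < q" using s by (cases "p = q") auto
  have cover: "\<exists>j\<in>{p..<q}. t j \<le> x \<and> x \<le> t (Suc j)" if x: "t p \<le> x" "x \<le> t q" for x
  proof -
    obtain i where "i < q - p" "t (p + i) \<le> x" "x \<le> t (p + Suc i)"
      using partition_covers[of "\<lambda>i. t (p + i)" x "q - p"] x pq by auto
    then show ?thesis by (intro bexI[of _ "p + i"]) auto
  qed
  obtain j where j: "j \<in> {p..<q}" "t j \<le> s" "s \<le> t (Suc j)" using cover[of s] s by auto
  obtain k where k: "k \<in> {p..<q}" "t k \<le> s'" "s' \<le> t (Suc k)" using cover[of s'] s by auto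
  have mono: "h i \<le> h i'" if "\<And>j. j \<in> {p..<q} \<Longrightarrow> h j \<le> h (Suc j)" "p \<le> i" "i \<le> i'" "i' \<le> q" for i i' and h :: "nat \<Rightarrow> real"
    using nondecreasing_upto[of "q - p" "\<lambda>i. h (p + i)" "i - p" "i' - p"] that by auto
  have "j \<le> k"
  proof (rule ccontr)
    assume "\<not> j \<le> k"
    then have "t (Suc k) \<le> t j" using mono[of t, OF incr, of "Suc k" j] j k by simp
    then show False using j k s False by simp
  qed
  then have "f (t j) \<le> f (t k)" using mono[of "\<lambda>j. f (t j)", OF up, of j k] j k by simp
  moreover have "\<bar>f s - f (t j)\<bar> \<le> e" "\<bar>f s' - f (t k)\<bar> \<le> e" using near j k by auto
  ultimately show ?thesis by linarith
qed

text \<open>The increments of \<open>f\<close> between division points have constant sign on each of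
  \<open>N\<close> blocks, and each block is approximately monotone. The form
  \<open>Suc (i - 1)\<close> is what unfolding \<open>d (i - 1)\<close> yields.\<close>

lemma approx_monotone_blocks:
  fixes f :: "real \<Rightarrow> real"
  assumes e: "0 \<le> e" and incr: "\<And>j. j < l \<Longrightarrow> t j \<le> t (Suc j)"
    and nz: "\<And>j. j < l \<Longrightarrow> f (t j) \<noteq> f (t (Suc j))"
    and near: "\<And>j s. j < l \<Longrightarrow> s \<in> {t j..t (Suc j)} \<Longrightarrow> \<bar>f s - f (t j)\<bar> \<le> e"
    and card: "card {i \<in> {1..<l}. (f (t (Suc (i - 1))) - f (t (i - 1))) * (f (t (Suc i)) - f (t i)) < 0} < N"
  shows "\<exists>\<tau>. \<tau> 0 = t 0 \<and> \<tau> N = t l \<and> (\<forall>i<N. \<tau> i \<le> \<tau> (Suc i) \<and>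
      ((\<forall>s s'. \<tau> i \<le> s \<and> s \<le> s' \<and> s' \<le> \<tau> (Suc i) \<longrightarrow> f s \<le> f s' + 2 * e) \<or>
       (\<forall>s s'. \<tau> i \<le> s \<and> s \<le> s' \<and> s' \<le> \<tau> (Suc i) \<longrightarrow> f s' \<le> f s + 2 * e)))"
proof -
  define d where "d j = f (t (Suc j)) - f (t j)" for j
  have "\<forall>j<l. d j \<noteq> 0" using nz unfolding d_def by force
  from constant_sign_blocks[OF this card[folded d_def]]
  obtain b where b: "b 0 = 0" "b N = l" "\<And>i. i < N \<Longrightarrow> b i \<le> b (Suc i)"
    and sgn: "\<And>i. i < N \<Longrightarrow> (\<forall>j\<in>{b i..<b (Suc i)}. 0 < d j) \<or> (\<forall>j\<in>{b i..<b (Suc i)}. d j < 0)"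
    by blast
  have bl: "b i \<le> l" if "i \<le> N" for i
    using nondecreasing_upto[of N "\<lambda>i. real (b i)" i N] b that by auto
  have "t (b i) \<le> t (b (Suc i))" if i: "i < N" for i
    using nondecreasing_upto[of l t, OF incr] bl[of "Suc i"] b(3)[OF i] i by simp
  moreover have "(\<forall>s s'. t (b i) \<le> s \<and> s \<le> s' \<and> s' \<le> t (b (Suc i)) \<longrightarrow> f s \<le> f s' + 2 * e) \<or>
       (\<forall>s s'. t (b i) \<le> s \<and> s \<le> s' \<and> s' \<le> t (b (Suc i)) \<longrightarrow> f s' \<le> f s + 2 * e)" if i: "i < N" for i
  proof -
    have jl: "j < l" if "j \<in> {b i..<b (Suc i)}" for j using that bl[of "Suc i"] i by auto
    from sgn[OF i] show ?thesis
    proof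
      assume pos: "\<forall>j\<in>{b i..<b (Suc i)}. 0 < d j"
      have "f s \<le> f s' + 2 * e" if "t (b i) \<le> s" "s \<le> s'" "s' \<le> t (b (Suc i))" for s s'
        by (rule approx_mono_block[of e "b i" "b (Suc i)" t f])
           (use pos that b(3)[OF i] e incr near jl in \<open>auto simp: d_def less_imp_le\<close>)
      then show ?thesis by blast
    next
      assume neg: "\<forall>j\<in>{b i..<b (Suc i)}. d j < 0"
      have "- f s \<le> - f s' + 2 * e" if "t (b i) \<le> s" "s \<le> s'" "s' \<le> t (b (Suc i))" for s s'
      proof (rule approx_mono_block[of e "b i" "b (Suc i)" t "\<lambda>x. - f x"])
        fix j x assume "j \<in> {b i..<b (Suc i)}" "x \<in> {t j..t (Suc j)}"
        then show "\<bar>- f x - - f (t j)\<bar> \<le> e" using near[of j x] jl[of j] by (simp add: abs_minus_commute)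
      qed (use neg that b(3)[OF i] e incr jl in \<open>auto simp: d_def less_imp_le\<close>)
      then have "f s' \<le> f s + 2 * e" if "t (b i) \<le> s" "s \<le> s'" "s' \<le> t (b (Suc i))" for s s'
        using that by force
      then show ?thesis by blast
    qed
  qed
  ultimately show ?thesis
    by (intro exI[of _ "\<lambda>i. t (b i)"]) (simp add: b)
qed

text \<open>Compactness: along a subsequence all division points converge, and by continuity the
  errors \<open>\<delta> m\<close> disappear in the limit.\<close>

lemma piecewise_monotone_limit:
  fixes f :: "real \<Rightarrow> real" and \<tau> :: "nat \<Rightarrow> nat \<Rightarrow> real"
  assumes cont: "continuous_on {a..b} f"
    and ends: "\<And>m. \<tau> m 0 = a" "\<And>m. \<tau> m N = b"
    and incr: "\<And>m i. i < N \<Longrightarrow> \<tau> m i \<le> \<tau> m (Suc i)"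
    and \<delta>: "\<delta> \<longlonglongrightarrow> 0"
    and mono: "\<And>m i. i < N \<Longrightarrow>
      (\<forall>s s'. \<tau> m i \<le> s \<and> s \<le> s' \<and> s' \<le> \<tau> m (Suc i) \<longrightarrow> f s \<le> f s' + \<delta> m) \<or>
      (\<forall>s s'. \<tau> m i \<le> s \<and> s \<le> s' \<and> s' \<le> \<tau> m (Suc i) \<longrightarrow> f s' \<le> f s + \<delta> m)"
  obtains \<sigma> where "\<sigma> 0 = a" "\<sigma> N = b" "\<And>i. i < N \<Longrightarrow> \<sigma> i \<le> \<sigma> (Suc i)"
    "\<And>i. i < N \<Longrightarrow> mono_on {\<sigma> i..\<sigma> (Suc i)} f \<or> antimono_on {\<sigma> i..\<sigma> (Suc i)} f"
proof -
  have range: "\<tau> m i \<in> {a..b}" if "i \<le> N" for m i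
    using nondecreasing_upto[of N "\<tau> m" 0 i] nondecreasing_upto[of N "\<tau> m" i N] incr ends that
    by auto
  have "norm (\<tau> m i) \<le> \<bar>a\<bar> + \<bar>b\<bar>" if "i \<in> {..N}" for m i
    using range[of i m] that by auto
  then obtain r where r: "strict_mono r" "\<And>i. i \<in> {..N} \<Longrightarrow> \<exists>x. (\<lambda>m. \<tau> (r m) i) \<longlonglongrightarrow> x"
    using function_convergent_subsequence[of "{..N}" \<tau> "\<bar>a\<bar> + \<bar>b\<bar>"]
    by (metis countable_finite finite_atMost)
  then obtain \<sigma> where \<sigma>: "\<And>i. i \<le> N \<Longrightarrow> (\<lambda>m. \<tau> (r m) i) \<longlonglongrightarrow> \<sigma> i"
    by (metis atMost_iff)
  have \<delta>r: "(\<lambda>m. \<delta> (r m)) \<longlonglongrightarrow> 0"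
    using LIMSEQ_subseq_LIMSEQ[OF \<delta> r(1)] by (simp add: o_def)
  have \<sigma>0: "\<sigma> 0 = a" "\<sigma> N = b"
    using \<sigma>[of 0] \<sigma>[of N] by (auto simp: ends LIMSEQ_const_iff)
  have \<sigma>range: "\<sigma> i \<in> {a..b}" if "i \<le> N" for i
    using LIMSEQ_le_const[OF \<sigma>[OF that], of a] LIMSEQ_le_const2[OF \<sigma>[OF that], of b] range[OF that]
    by auto
  have \<sigma>incr: "\<sigma> i \<le> \<sigma> (Suc i)" if "i < N" for i
    using \<sigma>[of i] \<sigma>[of "Suc i"] that incr by (intro LIMSEQ_le[of _ "\<sigma> i"]) auto
  have "mono_on {\<sigma> i..\<sigma> (Suc i)} f \<or> antimono_on {\<sigma> i..\<sigma> (Suc i)} f" if i: "i < N" for i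
  proof (rule ccontr)
    assume "\<not> ?thesis"
    \<comment> \<open>The direction of arc \<open>i\<close> may vary with \<open>m\<close>, so a
      strict descent and a strict ascent are both needed: whichever direction holds for a large
      \<open>m\<close>, one of the two contradicts it.\<close>
    then obtain s s' t t' where s: "\<sigma> i \<le> s" "s \<le> s'" "s' \<le> \<sigma> (Suc i)" "f s' < f s"
      and t: "\<sigma> i \<le> t" "t \<le> t'" "t' \<le> \<sigma> (Suc i)" "f t < f t'"
      unfolding monotone_on_def by (auto simp: not_le)
    \<comment> \<open>Transports points of the limit arc to points of the approximating arcs.\<close>
    define clamp where "clamp m x = max (\<tau> (r m) i) (min x (\<tau> (r m) (Suc i)))" for m x
    have lim: "(\<lambda>m. f (clamp m x)) \<longlonglongrightarrow> f x" if x: "\<sigma> i \<le> x" "x \<le> \<sigma> (Suc i)" for x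
    proof -
      have "(\<lambda>m. clamp m x) \<longlonglongrightarrow> max (\<sigma> i) (min x (\<sigma> (Suc i)))"
        unfolding clamp_def using i by (intro tendsto_intros \<sigma>) auto
      then have "(\<lambda>m. clamp m x) \<longlonglongrightarrow> x" using x by simp
      moreover have "clamp m x \<in> {a..b}" for m
        using range[of i "r m"] range[of "Suc i" "r m"] incr[OF i, of "r m"] i by (auto simp: clamp_def)
      moreover have "x \<in> {a..b}" using x \<sigma>range[of i] \<sigma>range[of "Suc i"] i by auto
      ultimately show ?thesis
        by (intro continuous_on_tendsto_compose[OF cont]) auto
    qed
    have "(\<lambda>m. f (clamp m s) - f (clamp m s') - \<delta> (r m)) \<longlonglongrightarrow> f s - f s' - 0"
      using s by (intro tendsto_intros lim \<delta>r) auto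
    then have "\<forall>\<^sub>F m in sequentially. 0 < f (clamp m s) - f (clamp m s') - \<delta> (r m)"
      using s by (intro order_tendstoD) auto
    moreover have "(\<lambda>m. f (clamp m t') - f (clamp m t) - \<delta> (r m)) \<longlonglongrightarrow> f t' - f t - 0"
      using t by (intro tendsto_intros lim \<delta>r) auto
    then have "\<forall>\<^sub>F m in sequentially. 0 < f (clamp m t') - f (clamp m t) - \<delta> (r m)"
      using t by (intro order_tendstoD) auto
    ultimately have "\<forall>\<^sub>F m in sequentially. False"
    proof eventually_elim
      case (elim m)
      have "\<tau> (r m) i \<le> clamp m x" "clamp m x \<le> \<tau> (r m) (Suc i)" for x
        using incr[OF i, of "r m"] by (auto simp: clamp_def)
      moreover have "clamp m s \<le> clamp m s'" "clamp m t \<le> clamp m t'"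
        using s t by (auto simp: clamp_def)
      ultimately show False using mono[OF i, of "r m"] elim by (smt (verit))
    qed
    then show False by simp
  qed
  then show ?thesis using that[of \<sigma>] \<sigma>0 \<sigma>incr by blast
qed

text \<open>Otherwise a subsequence of polygons has too few sign changes of \<open>u\<close> along
  the edges. In the limit, the height function \<open>f\<close> is monotone on each of
  \<open>2 * n - 1\<close> arcs, too few for \<open>2 * n\<close> cuts.\<close>

lemma eventually_many_sign_changes:
  fixes g :: "real \<Rightarrow> 'a::euclidean_space" and l :: "nat \<Rightarrow> nat" and t :: "nat \<Rightarrow> nat \<Rightarrow> real"
  defines "d \<equiv> \<lambda>u m j. u \<bullet> (g (t m (Suc j)) - g (t m j))"
  assumes cont: "continuous_on {0..2 * pi} g" and K: "\<And>x. g x = K (cis x)"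
    and l: "\<And>m. 0 < l m" and ends: "\<And>m. t m 0 = 0" "\<And>m. t m (l m) = 2 * pi"
    and incr: "\<And>m j. j < l m \<Longrightarrow> t m j < t m (Suc j)"
    and near: "\<And>m j s. j < l m \<Longrightarrow> s \<in> {t m j..t m (Suc j)} \<Longrightarrow> dist (g s) (g (t m j)) \<le> e m"
    and e: "e \<longlonglongrightarrow> 0" "\<And>m. 0 \<le> e m"
    and nz: "\<And>m j. j < l m \<Longrightarrow> d u m j \<noteq> 0"
    and cuts: "enat (2 * n) \<le> cuts K u c" and n: "1 \<le> n"
  shows "\<forall>\<^sub>F m in sequentially.
    2 * n \<le> card {i. i < l m \<and> d u m ((i + l m - 1) mod l m) * d u m i < 0}"
proof (rule ccontr)
  assume "\<not> ?thesis"
  from not_eventually_sequentiallyD[OF this, unfolded not_le] obtain q :: "nat \<Rightarrow> nat"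
    where q: "strict_mono q" and few: "\<And>m. card {i. i < l (q m) \<and> d u (q m) ((i + l (q m) - 1) mod l (q m)) * d u (q m) i < 0} < 2 * n"
    by blast
  define f where "f x = u \<bullet> g x" for x
  define N where "N = 2 * n - 1"
  define \<delta> where "\<delta> m = 2 * (norm u * e (q m))" for m
  have d: "d u m j = f (t m (Suc j)) - f (t m j)" for m j
    by (simp add: d_def f_def inner_diff_right)
  have "\<exists>\<tau>. \<tau> 0 = 0 \<and> \<tau> N = 2 * pi \<and> (\<forall>i<N. \<tau> i \<le> \<tau> (Suc i) \<and>
      ((\<forall>s s'. \<tau> i \<le> s \<and> s \<le> s' \<and> s' \<le> \<tau> (Suc i) \<longrightarrow> f s \<le> f s' + \<delta> m) \<or>
       (\<forall>s s'. \<tau> i \<le> s \<and> s \<le> s' \<and> s' \<le> \<tau> (Suc i) \<longrightarrow> f s' \<le> f s + \<delta> m)))" for m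
  proof -
    let ?t = "t (q m)" and ?l = "l (q m)"
    have "card {i \<in> {1..<?l}. d u (q m) (i - 1) * d u (q m) i < 0} < N"
      unfolding N_def using nz n by (intro card_sign_changes_less_of_cyclic few l) auto
    then have "card {i \<in> {1..<?l}. (f (?t (Suc (i - 1))) - f (?t (i - 1))) * (f (?t (Suc i)) - f (?t i)) < 0} < N"
      by (simp only: d)
    moreover have "f (?t j) \<noteq> f (?t (Suc j))" if "j < ?l" for j
      using nz[OF that] by (simp add: d)
    moreover have "\<bar>f s - f (?t j)\<bar> \<le> norm u * e (q m)" if "j < ?l" "s \<in> {?t j..?t (Suc j)}" for j s
    proof -
      have "\<bar>f s - f (?t j)\<bar> = \<bar>u \<bullet> (g s - g (?t j))\<bar>" by (simp add: f_def inner_diff_right)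
      also have "\<dots> \<le> norm u * norm (g s - g (?t j))" by (rule Cauchy_Schwarz_ineq2)
      also have "\<dots> \<le> norm u * e (q m)"
        using near[OF that] by (intro mult_left_mono) (auto simp: dist_norm)
      finally show ?thesis .
    qed
    ultimately show ?thesis
      using approx_monotone_blocks[of "norm u * e (q m)" ?l ?t f N] incr e(2)
      unfolding \<delta>_def by (simp add: ends less_imp_le)
  qed
  then obtain \<tau> where \<tau>: "\<And>m. \<tau> m 0 = 0" "\<And>m. \<tau> m N = 2 * pi"
    and \<tau>': "\<And>m i. i < N \<Longrightarrow> \<tau> m i \<le> \<tau> m (Suc i)"
      "\<And>m i. i < N \<Longrightarrow> (\<forall>s s'. \<tau> m i \<le> s \<and> s \<le> s' \<and> s' \<le> \<tau> m (Suc i) \<longrightarrow> f s \<le> f s' + \<delta> m) \<or>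
       (\<forall>s s'. \<tau> m i \<le> s \<and> s \<le> s' \<and> s' \<le> \<tau> m (Suc i) \<longrightarrow> f s' \<le> f s + \<delta> m)"
    by metis
  have cf: "continuous_on {0..2 * pi} f"
    unfolding f_def by (intro continuous_intros cont)
  have "(\<lambda>m. e (q m)) \<longlonglongrightarrow> 0"
    using LIMSEQ_subseq_LIMSEQ[OF e(1) q] by (simp add: o_def)
  then have "(\<lambda>m. 2 * (norm u * e (q m))) \<longlonglongrightarrow> 2 * (norm u * 0)"
    by (intro tendsto_intros)
  then have \<delta>: "\<delta> \<longlonglongrightarrow> 0" by (simp add: \<delta>_def[abs_def])
  obtain \<sigma> where \<sigma>: "\<sigma> 0 = 0" "\<sigma> N = 2 * pi" "\<And>i. i < N \<Longrightarrow> \<sigma> i \<le> \<sigma> (Suc i)"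
    "\<And>i. i < N \<Longrightarrow> mono_on {\<sigma> i..\<sigma> (Suc i)} f \<or> antimono_on {\<sigma> i..\<sigma> (Suc i)} f"
    using piecewise_monotone_limit[OF cf \<tau> \<tau>'(1) \<delta> \<tau>'(2)] by metis
  \<comment> \<open>The first edge is not orthogonal to \<open>u\<close>, so \<open>f\<close> is not
    constant and the curve lies in no hyperplane orthogonal to \<open>u\<close>.\<close>
  have f01: "f 0 \<noteq> f (t 0 (Suc 0))"
    using nz[of 0 0] l[of 0] ends(1)[of 0] by (simp add: d)
  show False
  \<comment> \<open>Counting cuts needs at least two arcs. For \<open>n = 1\<close> there is only
    one, and a function that is monotone over a full period with equal end values is
    constant.\<close>
  proof (cases "N = 1")
    case True
    have x: "t 0 (Suc 0) \<in> {0..2 * pi}"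
      using nondecreasing_upto[of "l 0" "t 0" 0 "Suc 0"] nondecreasing_upto[of "l 0" "t 0" "Suc 0" "l 0"]
        incr[of _ 0] l[of 0] ends[of 0] by (simp add: less_imp_le Suc_le_eq)
    have loop: "f 0 = f (2 * pi)" by (simp add: f_def K)
    from \<sigma>(1,2) \<sigma>(4)[of 0] True
    have "mono_on {0..2 * pi} f \<or> antimono_on {0..2 * pi} f" by simp
    then show False
    proof
      assume "mono_on {0..2 * pi} f"
      from monotone_onD[OF this, of 0 "t 0 (Suc 0)"] monotone_onD[OF this, of "t 0 (Suc 0)" "2 * pi"]
      show False using x loop f01 by simp
    next
      assume "antimono_on {0..2 * pi} f"
      from monotone_onD[OF this, of 0 "t 0 (Suc 0)"] monotone_onD[OF this, of "t 0 (Suc 0)" "2 * pi"]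
      show False using x loop f01 by simp
    qed
  next
    case False
    then have N2: "2 \<le> N" using n by (simp add: N_def)
    have notin: "\<not> K ` sphere 0 1 \<subseteq> hyperplane u c"
    proof
      assume "K ` sphere 0 1 \<subseteq> hyperplane u c"
      then have "f x = c" for x
        by (auto simp: f_def K hyperplane_def image_subset_iff)
      then show False using f01 by simp
    qed
    have "cuts K u c \<le> enat N"
      using \<sigma> by (intro cuts_le_monotone_arcs[OF N2 _ _ _ _ notin, of \<sigma>]) (auto simp: f_def[abs_def] K)
    with cuts have "enat (2 * n) \<le> enat N" by (rule order_trans)
    then show False using n by (simp add: N_def)
  qed
qed

text \<open>Translates between the cyclic indices of polygon vertices and the linear indices of a
  partition, whose point \<open>l\<close> repeats point 0.\<close>

lemma cyclic_edges:
  assumes "0 < l" "v 0 = v l"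
  shows "i < l \<Longrightarrow> v (Suc i mod l) = v (Suc i)"
    and "i < l \<Longrightarrow> v i - v ((i + l - 1) mod l) = v (Suc ((i + l - 1) mod l)) - v ((i + l - 1) mod l)"
proof -
  show "i < l \<Longrightarrow> v (Suc i mod l) = v (Suc i)"
    using assms by (cases "Suc i = l") auto
  assume i: "i < l"
  have "v (Suc ((i + l - 1) mod l)) = v i"
  proof (cases "i = 0")
    case True
    then show ?thesis using assms by simp
  next
    case False
    then show ?thesis using pred_mod_eq[of i l] i by simp
  qed
  then show "v i - v ((i + l - 1) mod l) = v (Suc ((i + l - 1) mod l)) - v ((i + l - 1) mod l)"
    by simp
qed

lemma exterior_angle_nonneg: "0 \<le> exterior_angle v w"
proof -
  have "\<bar>v \<bullet> w / (norm v * norm w)\<bar> \<le> 1"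
    using Cauchy_Schwarz_ineq2[of v w] by (simp add: abs_mult divide_le_eq)
  then show ?thesis unfolding exterior_angle_def by (intro arccos_lbound) linarith+
qed

text \<open>The vertices are taken at \<open>t 0\<close> up to \<open>t (l - 1)\<close>; the
  parameter \<open>t l\<close> is left out since it gives the first vertex again.\<close>

lemma polygon_total_curvature_le:
  fixes t :: "nat \<Rightarrow> real"
  assumes l: "0 < l" and ends: "t 0 = 0" "t l = 2 * pi"
    and incr: "\<And>j. j < l \<Longrightarrow> t j < t (Suc j)"
    and ne: "\<And>j. j < l \<Longrightarrow> K (cis (t j)) \<noteq> K (cis (t (Suc j)))"
  defines "D \<equiv> \<lambda>j. K (cis (t (Suc j))) - K (cis (t j))"
  shows "ennreal (\<Sum>i<l. exterior_angle (D ((i + l - 1) mod l)) (D i)) \<le> total_curvature K"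
proof -
  define ts where "ts = map t [0..<l]"
  define vs where "vs = map (\<lambda>x. K (cis x)) ts"
  have len: "length vs = l" by (simp add: vs_def ts_def)
  have nth: "vs ! i = K (cis (t i))" if "i < l" for i using that by (simp add: vs_def ts_def)
  define v where "v i = K (cis (t i))" for i
  have v: "v 0 = v l" by (simp add: v_def ends)
  have D: "D j = v (Suc j) - v j" for j by (simp add: D_def v_def)
  have smono: "t i < t j" if "i < j" "j \<le> l" for i j
    using nondecreasing_upto[of l t "Suc i" j, OF less_imp_le[OF incr]] incr[of i] that by simp
  have "sorted_wrt (<) ts" using smono by (auto simp: ts_def sorted_wrt_iff_nth_less)
  moreover have "last ts < hd ts + 2 * pi"
    using l smono[of "l - 1" l] ends by (simp add: ts_def last_map hd_map)
  moreover have "closed_polygon vs"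
    unfolding closed_polygon_def
  proof (intro conjI allI impI)
    show "vs \<noteq> []" using l len by auto
    fix i assume i: "i < length vs"
    have "v i \<noteq> v (Suc i mod l)" using cyclic_edges(1)[of l v i] l v ne i by (auto simp: v_def len)
    then show "vs ! i \<noteq> vs ! (Suc i mod length vs)" using i l by (simp add: len nth v_def)
  qed
  ultimately have "inscribed_polygon K vs"
    unfolding inscribed_polygon_def vs_def by blast
  then have "ennreal (polygon_total_curvature vs) \<le> total_curvature K"
    unfolding total_curvature_def by (intro SUP_upper) auto
  moreover have "polygon_total_curvature vs = (\<Sum>i<l. exterior_angle (D ((i + l - 1) mod l)) (D i))"
    unfolding polygon_total_curvature_def len
  proof (intro sum.cong refl)
    fix i assume "i \<in> {..<l}"
    then have i: "i < l" by simp
    then have "(i + l - 1) mod l < l" by simp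
    then have "vs ! i - vs ! ((i + l - 1) mod l) = D ((i + l - 1) mod l)"
      using cyclic_edges(2)[OF l v i] i by (simp add: nth D flip: v_def)
    moreover have "vs ! (Suc i mod l) - vs ! i = D i"
      using cyclic_edges(1)[of l v, OF l v i] i l by (simp add: nth D flip: v_def)
    ultimately show "exterior_angle (vs ! i - vs ! ((i + l - 1) mod l)) (vs ! (Suc i mod l) - vs ! i)
        = exterior_angle (D ((i + l - 1) mod l)) (D i)" by simp
  qed
  ultimately show ?thesis by simp
qed

subsection \<open>Averaging over directions\<close>

text \<open>A constant curve has no inscribed polygons here and hence total curvature 0, yet it cuts
  each hyperplane through its only point twice, so its first hull is nonempty. This is why constant
  curves are excluded.\<close>

theorem total_curvature_ge_of_nth_hull:
  fixes K :: "complex \<Rightarrow> real ^ 'n::{finite,wellorder}"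
  assumes n: "n \<ge> 1" and K: "closed_curve K" and nc: "\<not> K constant_on sphere 0 1"
    and hull: "nth_hull n K \<noteq> {}"
  shows "total_curvature K \<ge> ennreal (2 * pi * real n)"
proof -
  define g where "g x = K (cis x)" for x
  have cont: "continuous_on {0..2 * pi} g"
    unfolding g_def using K unfolding closed_curve_def
    by (rule continuous_on_compose2) (auto intro!: continuous_intros)
  from nc have "\<exists>z\<in>sphere 0 1. K z \<noteq> K 1"
    unfolding constant_on_def by blast
  then obtain z where z: "norm z = 1" "K z \<noteq> K 1" by auto
  have "cis (Arg2pi z) = z"
    using z by (simp add: complex_norm_eq_1_exp cis_conv_exp)
  then have s0: "Arg2pi z \<in> {0..2 * pi}" "g (Arg2pi z) \<noteq> g 0"
    using z Arg2pi_ge_0[of z] Arg2pi_lt_2pi[of z] by (auto simp: g_def)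
  have loop: "g 0 = g (2 * pi)" by (simp add: g_def)
  define e where "e m = 1 / real (Suc m)" for m
  have e: "0 < e m" for m by (simp add: e_def)
  have e_lim: "e \<longlonglongrightarrow> 0" unfolding e_def by (rule LIMSEQ_Suc[OF lim_1_over_n])
  have "\<exists>l t. 0 < l \<and> t 0 = 0 \<and> t l = 2 * pi \<and> (\<forall>j<l. t j < t (Suc j)) \<and>
    (\<forall>j<l. g (t j) \<noteq> g (t (Suc j))) \<and>
    (\<forall>j<l. \<forall>s\<in>{t j..t (Suc j)}. dist (g s) (g (t j)) \<le> e m)" for m
    by (rule fine_partition[OF cont _ loop s0 e[of m]]) (simp, blast)
  then obtain l t where l: "\<And>m. 0 < l m" and ends: "\<And>m. t m 0 = 0" "\<And>m. t m (l m) = 2 * pi"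
    and incr: "\<And>m j. j < l m \<Longrightarrow> t m j < t m (Suc j)"
    and ne: "\<And>m j. j < l m \<Longrightarrow> g (t m j) \<noteq> g (t m (Suc j))"
    and near: "\<And>m j s. j < l m \<Longrightarrow> s \<in> {t m j..t m (Suc j)} \<Longrightarrow> dist (g s) (g (t m j)) \<le> e m"
    by metis
  define D where "D m j = g (t m (Suc j)) - g (t m j)" for m j
  define A where "A m i = crossing_set (D m ((i + l m - 1) mod l m)) (D m i)" for m i
  define B where "B = ball (0::(real,'n) vec) 1"
  \<comment> \<open>For \<open>u\<close> in the ball, \<open>h m u\<close> is \<pi> times the number
    of sign changes of \<open>u\<close> around the \<open>m\<close>th polygon; outside the ball it
    is 0.\<close>
  define h where "h m u = (\<Sum>i<l m. ennreal pi * indicator (A m i) u)" for m u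
  have D0: "D m j \<noteq> 0" if "j < l m" for m j using ne[OF that] by (simp add: D_def)
  have meas: "A m i \<in> sets lebesgue" for m i
    unfolding A_def by (intro fmeasurableD lmeasurable_crossing_set)
  have hmeas: "h m \<in> borel_measurable lebesgue" for m
    unfolding h_def[abs_def] using meas by measurable
  have eB: "emeasure lebesgue B = ennreal (measure lebesgue B)"
    unfolding B_def by (intro emeasure_eq_ennreal_measure fmeasurableD2) auto
  have int: "(\<integral>\<^sup>+u. h m u \<partial>lebesgue) \<le> total_curvature K * emeasure lebesgue B" for m
  proof -
    let ?\<theta> = "\<lambda>i. exterior_angle (D m ((i + l m - 1) mod l m)) (D m i)"
    have "(\<integral>\<^sup>+u. h m u \<partial>lebesgue) = (\<Sum>i<l m. ennreal pi * emeasure lebesgue (A m i))"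
      unfolding h_def using meas
      by (subst nn_integral_sum) (auto intro!: sum.cong nn_integral_cmult_indicator simp del: emeasure_completion)
    also have "\<dots> = (\<Sum>i<l m. ennreal (pi * measure lebesgue (A m i)))"
    proof (intro sum.cong refl)
      fix i
      have "emeasure lebesgue (A m i) = ennreal (measure lebesgue (A m i))"
        unfolding A_def by (intro emeasure_eq_ennreal_measure fmeasurableD2 lmeasurable_crossing_set)
      then show "ennreal pi * emeasure lebesgue (A m i) = ennreal (pi * measure lebesgue (A m i))"
        by (simp only: ennreal_mult pi_ge_zero measure_nonneg)
    qed
    also have "\<dots> \<le> (\<Sum>i<l m. ennreal (?\<theta> i * measure lebesgue B))"
      unfolding A_def B_def
      by (intro sum_mono ennreal_leI measure_crossing_set_le D0) (use l in auto)
    also have "\<dots> = ennreal (\<Sum>i<l m. ?\<theta> i) * ennreal (measure lebesgue B)"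
      by (simp add: exterior_angle_nonneg sum_nonneg sum_distrib_right flip: ennreal_mult)
    also have "\<dots> \<le> total_curvature K * emeasure lebesgue B"
      unfolding eB
      using polygon_total_curvature_le[of "l m" "t m" K] l ends incr ne
      by (intro mult_right_mono) (auto simp: D_def g_def)
    finally show ?thesis .
  qed
  obtain p where p: "\<And>u. u \<noteq> 0 \<Longrightarrow> enat (2 * n) \<le> cuts K u (u \<bullet> p)"
    using hull by (auto simp: nth_hull_def)
  \<comment> \<open>The exceptional directions are orthogonal to one of countably many edges, hence
    lie in a countable union of hyperplanes.\<close>
  have "AE u in lebesgue. \<forall>m. \<forall>j\<in>{..<l m}. u \<bullet> D m j \<noteq> 0"
  proof -
    have "AE u in lebesgue. u \<bullet> D m j \<noteq> 0" if "j < l m" for m j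
    proof -
      have "negligible {u. D m j \<bullet> u = 0}" using D0[OF that] by (intro negligible_hyperplane) auto
      then show ?thesis
        by (intro AE_I'[of "{u. D m j \<bullet> u = 0}"]) (auto simp: negligible_iff_null_sets inner_commute)
    qed
    then show ?thesis by (subst AE_all_countable) (auto intro!: AE_finite_allI)
  qed
  then have liminf: "AE u in lebesgue. ennreal (2 * pi * real n) * indicator B u \<le> liminf (\<lambda>m. h m u)"
  proof eventually_elim
    case (elim u)
    have "u \<noteq> 0" using elim l[of 0] by auto
    have "\<forall>\<^sub>F m in sequentially.
      2 * n \<le> card {i. i < l m \<and> (u \<bullet> D m ((i + l m - 1) mod l m)) * (u \<bullet> D m i) < 0}"
      unfolding D_def
      by (rule eventually_many_sign_changes[where K = K and e = e and c = "u \<bullet> p"])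
         (use cont l ends incr near elim e_lim e n p[OF \<open>u \<noteq> 0\<close>] in \<open>auto simp: g_def D_def less_imp_le\<close>)
    then have "\<forall>\<^sub>F m in sequentially. ennreal (2 * pi * real n) * indicator B u \<le> h m u"
    proof eventually_elim
      case (elim m)
      show ?case
      proof (cases "u \<in> B")
        case True
        let ?S = "{i. i < l m \<and> (u \<bullet> D m ((i + l m - 1) mod l m)) * (u \<bullet> D m i) < 0}"
        have "h m u = (\<Sum>i\<in>?S. ennreal pi)"
          unfolding h_def using True
          by (intro sum.mono_neutral_cong_right) (auto simp: A_def B_def crossing_set_def indicator_def)
        also have "\<dots> = ennreal (pi * real (card ?S))"
          by (simp add: ennreal_mult ennreal_of_nat_eq_real_of_nat mult.commute)
        also have "\<dots> \<ge> ennreal (2 * pi * real n)"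
          using elim by (intro ennreal_leI) (simp add: mult.commute mult.left_commute flip: of_nat_mult)
        finally show ?thesis using True by simp
      qed simp
    qed
    then show ?case by (intro Liminf_bounded)
  qed
  have "ennreal (2 * pi * real n) * emeasure lebesgue B
      = (\<integral>\<^sup>+u. ennreal (2 * pi * real n) * indicator B u \<partial>lebesgue)"
    by (simp add: nn_integral_cmult_indicator B_def)
  also have "\<dots> \<le> (\<integral>\<^sup>+u. liminf (\<lambda>m. h m u) \<partial>lebesgue)"
    by (rule nn_integral_mono_AE[OF liminf])
  also have "\<dots> \<le> liminf (\<lambda>m. \<integral>\<^sup>+u. h m u \<partial>lebesgue)"
    by (rule nn_integral_liminf[OF hmeas])
  also have "\<dots> \<le> total_curvature K * emeasure lebesgue B"
    using int by (intro Liminf_le) auto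
  finally have "emeasure lebesgue B * ennreal (2 * pi * real n) \<le> emeasure lebesgue B * total_curvature K"
    by (simp add: mult.commute)
  \<comment> \<open>The volume of the ball is positive and finite, so it cancels even if the total
    curvature is infinite.\<close>
  moreover have "emeasure lebesgue B \<noteq> 0"
    unfolding eB using content_ball_pos[of 1 "0::(real,'n) vec"] by (simp add: B_def)
  moreover have "emeasure lebesgue B \<noteq> top" unfolding eB by simp
  ultimately show ?thesis using ennreal_mult_le_mult_iff by blast
qed

theorem mainTheorem4:
  fixes n :: nat and K :: "complex \<Rightarrow> real ^ 3"
  assumes "n \<ge> 1"
    and "closed_curve K"
    and "\<not> K constant_on sphere 0 1"
    and "nth_hull n K \<noteq> {}"
  shows "total_curvature K \<ge> ennreal (2 * pi * real n)"
  using assms by (rule total_curvature_ge_of_nth_hull)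

end
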